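(* Let $V$ be a general renormalizable three-Higgs-doublet potential, written in bilinear form as $V = M_0 r_0 + M_i r_i + \Lambda_0 r_0^2 + L_i r_0 r_i + \Lambda_{ij} r_i r_j$ with $M, L\in\mathbb{R}^8$ and $\Lambda$ a real symmetric $8\times 8$ matrix. Then $V$ possesses a CP4 symmetry (a $CP$ symmetry of order 4) if and only if there exists a nonzero vector $v^{(8)}\in\mathbb{R}^8$ for which all of the following conditions are satisfied: (1) $v^{(8)}$ is an eigenvector of $\Lambda$ and is self-aligned, i.e. the vector with components $d_{ijk}v^{(8)}_j v^{(8)}_k$ is parallel to $v^{(8)}$; (2) there exist exactly three other (nonzero) mutually orthogonal eigenvectors $v^{(1)},v^{(2)},v^{(3)}$ of $\Lambda$, each orthogonal to $v^{(8)}$, which are $f$-orthogonal to $v^{(8)}$: $f_{ijk}v^{(8)}_j v^{(\alpha)}_k = 0$ for all $i$ and $\alpha=1,2,3$ (that is, three is the maximal number of such mutually orthogonal eigenvectors, and it is attained); (3) each of the vectors $M$, $L$, $K$ with $K_i = d_{ijk}\Lambda_{jk}$, and $K^{(2)}$ with $K^{(2)}_i = d_{ijk}(\Lambda^2)_{jk}$, if non-zero, is parallel to $v^{(8)}$.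
   Context: Setting. There are three Higgs doublets $\phi_a\in\mathbb{C}^2$, $a=1,2,3$, and the (real-valued) potential is $V=Y_{ab}(\phi_a^\dagger\phi_b)+Z_{abcd}(\phi_a^\dagger\phi_b)(\phi_c^\dagger\phi_d)$ (repeated indices summed). Let $t_i=\lambda_i/2$, $i=1,\dots,8$, with $\lambda_i$ the standard Gell-Mann matrices. The tensors $f_{ijk}$ (totally antisymmetric) and $d_{ijk}$ (totally symmetric) are defined by $[t_i,t_j]=i f_{ijk}t_k$ and $\{t_i,t_j\}=\frac13\delta_{ij}\mathbf{1}_3+d_{ijk}t_k$. The bilinears are $r_0=\frac{1}{\sqrt3}\phi_a^\dagger\phi_a$ and $r_i=\phi_a^\dagger(t_i)_{ab}\phi_b$. Every potential $V$ can be written uniquely as $V = M_0 r_0 + M_i r_i + \Lambda_0 r_0^2 + L_i r_0 r_i + \Lambda_{ij} r_i r_j$ with real coefficients and $\Lambda_{ij}=\Lambda_{ji}$. CP symmetries. A (generalized) $CP$ transformation is a map $\phi_a\mapsto X_{ab}\phi_b^*$ with $X$ a unitary $3\times3$ matrix ($*$ is componentwise complex conjugation of the doublets; the space-time argument is suppressed). It is a symmetry of $V$ if $V$ is invariant under it. Applying it twice gives the transformation $\phi_a\mapsto (XX^* )_{ab}\phi_b$. Under a unitary basis change $\phi\mapsto U\phi$ the matrix $X$ becomes $UXU^{T}$. The $CP$ transformation has order 4 (is a CP4) if $XX^*\neq\mathbf 1$ and $(XX^* )^2=\mathbf 1$; equivalently, there is a basis in which $X=\begin{pmatrix}0&1&0\\-1&0&0\\0&0&1\end{pmatrix}$.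 *)

theory Defs
  imports "HOL-Analysis.Analysis"
begin

section \<open>Complex matrices\<close>

definition cnj_matrix :: "complex^'n^'m \<Rightarrow> complex^'n^'m" where
  "cnj_matrix A = (\<chi> i j. cnj (A $ i $ j))"

definition unitary_matrix :: "complex^'n^'n \<Rightarrow> bool" where
  "unitary_matrix U \<longleftrightarrow>
     transpose (cnj_matrix U) ** U = mat 1 \<and> U ** transpose (cnj_matrix U) = mat 1"


section \<open>Gell-Mann matrices and the tensors f and d\<close>

text \<open>
  The index type \<^typ>\<open>8\<close> consists of the eight elements 1, ..., 8 (with 8 = 0), and
  \<^typ>\<open>3\<close> of 1, 2, 3 (with 3 = 0).
\<close>

definition gell_mann :: "8 \<Rightarrow> complex^3^3" where
  "gell_mann i =
    (if i = 1 then vector [vector [0, 1, 0], vector [1, 0, 0], vector [0, 0, 0]]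
     else if i = 2 then vector [vector [0, -\<i>, 0], vector [\<i>, 0, 0], vector [0, 0, 0]]
     else if i = 3 then vector [vector [1, 0, 0], vector [0, -1, 0], vector [0, 0, 0]]
     else if i = 4 then vector [vector [0, 0, 1], vector [0, 0, 0], vector [1, 0, 0]]
     else if i = 5 then vector [vector [0, 0, -\<i>], vector [0, 0, 0], vector [\<i>, 0, 0]]
     else if i = 6 then vector [vector [0, 0, 0], vector [0, 0, 1], vector [0, 1, 0]]
     else if i = 7 then vector [vector [0, 0, 0], vector [0, 0, -\<i>], vector [0, \<i>, 0]]
     else (1 / sqrt 3) *\<^sub>R vector [vector [1, 0, 0], vector [0, 1, 0], vector [0, 0, -2]])"

definition su3_gen :: "8 \<Rightarrow> complex^3^3" where
  "su3_gen i = (1 / 2) *\<^sub>R gell_mann i"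

text \<open>
  The tensors are the unique real coefficients in
  $[t_i,t_j] = i f_{ijk} t_k$ and $\{t_i,t_j\} = \frac13 \delta_{ij} 1 + d_{ijk} t_k$;
  existence and uniqueness are proved below.
\<close>

definition su3_f :: "8 \<Rightarrow> 8 \<Rightarrow> 8 \<Rightarrow> real" where
  "su3_f = (THE f. \<forall>i j. su3_gen i ** su3_gen j - su3_gen j ** su3_gen i
      = mat \<i> ** (\<Sum>k\<in>UNIV. f i j k *\<^sub>R su3_gen k))"

definition su3_d :: "8 \<Rightarrow> 8 \<Rightarrow> 8 \<Rightarrow> real" where
  "su3_d = (THE d. \<forall>i j. su3_gen i ** su3_gen j + su3_gen j ** su3_gen i
      = mat (if i = j then 1 / 3 else 0) + (\<Sum>k\<in>UNIV. d i j k *\<^sub>R su3_gen k))"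

lemma UNIV_8: "(UNIV :: 8 set) = {1, 2, 3, 4, 5, 6, 7, 8}"
proof -
  have "card {1, 2, 3, 4, 5, 6, 7, 8 :: 8} = CARD(8)" by simp
  then show ?thesis by (metis card_eq_UNIV_imp_eq_UNIV finite)
qed

lemma forall_8: "(\<forall>i::8. P i) \<longleftrightarrow> P 1 \<and> P 2 \<and> P 3 \<and> P 4 \<and> P 5 \<and> P 6 \<and> P 7 \<and> P 8"
proof -
  have "(\<forall>i::8. P i) \<longleftrightarrow> (\<forall>i\<in>(UNIV::8 set). P i)" by simp
  then show ?thesis unfolding UNIV_8 by simp
qed

lemma sum_8: "sum g (UNIV::8 set) = g 1 + g 2 + g 3 + g 4 + g 5 + g 6 + g 7 + g 8"
  unfolding UNIV_8 by (simp add: ac_simps)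

lemma sqrt3_complex: "complex_of_real (sqrt 3) * complex_of_real (sqrt 3) = 3"
  by (metis abs_numeral of_real_mult of_real_numeral real_sqrt_abs2 real_sqrt_mult)

lemma gell_mann_hermitian: "cnj (gell_mann i $ a $ b) = gell_mann i $ b $ a"
proof -
  have "\<forall>i a b. cnj (gell_mann i $ a $ b) = gell_mann i $ b $ a"
    unfolding forall_8 forall_3 by (simp add: gell_mann_def)
  then show ?thesis by blast
qed

lemma gell_mann_trace: "trace (gell_mann i) = 0"
proof -
  have "\<forall>i. trace (gell_mann i) = 0"
    unfolding forall_8 by (simp add: gell_mann_def trace_def sum_3)
  then show ?thesis by blast
qed

lemma gell_mann_orth: "trace (gell_mann i ** gell_mann j) = (if i = j then 2 else 0)"
proof -
  have "\<forall>i j. trace (gell_mann i ** gell_mann j) = (if i = j then 2 else 0)"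
    unfolding forall_8
    by (simp add: gell_mann_def trace_def matrix_matrix_mult_def sum_3 field_simps sqrt3_complex
        scaleR_conv_of_real[where 'a = complex])
  then show ?thesis by blast
qed

lemma gell_mann_expansion:
  "A $ a $ b = (if a = b then trace A / 3 else 0)
     + (\<Sum>k\<in>UNIV. trace (A ** gell_mann k) / 2 * gell_mann k $ a $ b)"
proof -
  have "\<forall>a b. A $ a $ b = (if a = b then trace A / 3 else 0)
     + (\<Sum>k\<in>UNIV. trace (A ** gell_mann k) / 2 * gell_mann k $ a $ b)"
    unfolding forall_3 sum_8
    by (simp add: gell_mann_def trace_def matrix_matrix_mult_def sum_3
        scaleR_conv_of_real[where 'a = complex] field_simps sqrt3_complex)
  then show ?thesis by blast
qed

lemma su3_gen_hermitian: "cnj (su3_gen i $ a $ b) = su3_gen i $ b $ a"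
  by (simp add: su3_gen_def gell_mann_hermitian)

lemma su3_expansion:
  assumes herm: "\<And>a b. cnj (A $ a $ b) = A $ b $ a" and tr: "trace A = 0"
  shows "A = (\<Sum>k\<in>UNIV. Re (trace (A ** gell_mann k)) *\<^sub>R su3_gen k)"
proof -
  have "cnj (trace (A ** gell_mann k)) = trace (A ** gell_mann k)" for k
    unfolding trace_def matrix_matrix_mult_def
    by (simp add: herm gell_mann_hermitian) (subst sum.swap, simp)
  then have re: "complex_of_real (Re (trace (A ** gell_mann k))) = trace (A ** gell_mann k)" for k
    by (metis Reals_cnj_iff of_real_Re)
  have "A $ a $ b = (\<Sum>k\<in>UNIV. Re (trace (A ** gell_mann k)) *\<^sub>R su3_gen k) $ a $ b" for a b
    by (subst gell_mann_expansion) (simp add: tr su3_gen_def scaleR_conv_of_real[where 'a = complex] re)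
  then show ?thesis by (simp add: vec_eq_iff)
qed

lemma su3_coeff:
  "trace ((\<Sum>k\<in>UNIV. c k *\<^sub>R su3_gen k) ** gell_mann m) = complex_of_real (c m)"
proof -
  have scale: "trace ((r *\<^sub>R su3_gen k) ** gell_mann m)
      = complex_of_real (r / 2) * trace (gell_mann k ** gell_mann m)" for r k
    by (simp add: trace_def matrix_matrix_mult_def su3_gen_def sum_distrib_left
        scaleR_conv_of_real[where 'a = complex] mult.assoc)
  have add: "(A + B) ** C = A ** C + B ** C" for A B C :: "complex^3^3"
    by (simp add: matrix_matrix_mult_def vec_eq_iff distrib_right sum.distrib)
  have "trace ((\<Sum>k\<in>K. c k *\<^sub>R su3_gen k) ** gell_mann m)
      = (\<Sum>k\<in>K. complex_of_real (c k / 2) * trace (gell_mann k ** gell_mann m))" for K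
  proof (induction K rule: infinite_finite_induct)
    case (insert k K)
    then show ?case
      by (simp add: add trace_add scale)
  qed (simp_all add: trace_def matrix_matrix_mult_def)
  then have "trace ((\<Sum>k\<in>UNIV. c k *\<^sub>R su3_gen k) ** gell_mann m)
      = (\<Sum>k\<in>UNIV. if k = m then complex_of_real (c k) else 0)"
    by (simp only: gell_mann_orth) (rule sum.cong, simp_all)
  then show ?thesis by simp
qed

lemma su3_coeff_unique:
  assumes "(\<Sum>k\<in>UNIV. c k *\<^sub>R su3_gen k) = (\<Sum>k\<in>UNIV. c' k *\<^sub>R su3_gen k)"
  shows "c = c'"
proof
  show "c m = c' m" for m
    using su3_coeff[of c m] su3_coeff[of c' m] unfolding assms by simp
qed

lemma mat_mult_entry: "(mat c ** (A :: complex^3^3)) $ a $ b = c * A $ a $ b"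
proof -
  have "\<forall>a b. (mat c ** A) $ a $ b = c * A $ a $ b"
    unfolding forall_3 by (simp add: matrix_matrix_mult_def mat_def sum_3)
  then show ?thesis by blast
qed

lemma mat_ii_swap:
  fixes A S :: "complex^3^3"
  shows "mat (- \<i>) ** A = S \<Longrightarrow> A = mat \<i> ** S"
    and "A = mat \<i> ** S \<Longrightarrow> S = mat (- \<i>) ** A"
  by (drule sym, simp add: vec_eq_iff mat_mult_entry) (simp add: vec_eq_iff mat_mult_entry)

lemma diff_eq_swap: "(A :: complex^3^3) - B = S \<Longrightarrow> A = B + S"
  by auto

lemma cnj_mult_su3_gen:
  "cnj ((su3_gen i ** su3_gen j) $ a $ b) = (su3_gen j ** su3_gen i) $ b $ a"
  by (simp add: matrix_matrix_mult_def su3_gen_hermitian mult.commute)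

lemma trace_su3_gen_mult: "trace (su3_gen i ** su3_gen j) = (if i = j then 1 / 2 else 0)"
proof -
  have "trace (su3_gen i ** su3_gen j) = trace (gell_mann i ** gell_mann j) / 4"
    by (simp add: trace_def matrix_matrix_mult_def su3_gen_def sum_divide_distrib
        scaleR_conv_of_real[where 'a = complex])
  then show ?thesis by (simp only: gell_mann_orth) simp
qed

lemma su3_f_ex1:
  "\<exists>!f. \<forall>i j. su3_gen i ** su3_gen j - su3_gen j ** su3_gen i
      = mat \<i> ** (\<Sum>k\<in>UNIV. f i j k *\<^sub>R su3_gen k)"
proof (rule ex_ex1I)
  let ?A = "\<lambda>i j. mat (- \<i>) ** (su3_gen i ** su3_gen j - su3_gen j ** su3_gen i)"
  have *: "?A i j = (\<Sum>k\<in>UNIV. Re (trace (?A i j ** gell_mann k)) *\<^sub>R su3_gen k)" for i j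
  proof (rule su3_expansion)
    show "cnj (?A i j $ a $ b) = ?A i j $ b $ a" for a b
      by (simp add: mat_mult_entry cnj_mult_su3_gen algebra_simps)
    have "trace (?A i j) = - \<i> * (trace (su3_gen i ** su3_gen j) - trace (su3_gen j ** su3_gen i))"
      unfolding trace_def by (simp add: mat_mult_entry sum_3 algebra_simps)
    then show "trace (?A i j) = 0" by (simp add: trace_su3_gen_mult)
  qed
  show "\<exists>f. \<forall>i j. su3_gen i ** su3_gen j - su3_gen j ** su3_gen i
      = mat \<i> ** (\<Sum>k\<in>UNIV. f i j k *\<^sub>R su3_gen k)"
    by (rule exI, intro allI, rule mat_ii_swap(1)[OF *])
next
  fix f g :: "8 \<Rightarrow> 8 \<Rightarrow> 8 \<Rightarrow> real"
  assume f: "\<forall>i j. su3_gen i ** su3_gen j - su3_gen j ** su3_gen i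
      = mat \<i> ** (\<Sum>k\<in>UNIV. f i j k *\<^sub>R su3_gen k)"
    and g: "\<forall>i j. su3_gen i ** su3_gen j - su3_gen j ** su3_gen i
      = mat \<i> ** (\<Sum>k\<in>UNIV. g i j k *\<^sub>R su3_gen k)"
  have "f i j = g i j" for i j
    by (rule su3_coeff_unique, rule trans[OF mat_ii_swap(2)[OF f[rule_format]]],
        rule mat_ii_swap(2)[OF g[rule_format], symmetric])
  then show "f = g" by blast
qed

lemma su3_d_ex1:
  "\<exists>!d. \<forall>i j. su3_gen i ** su3_gen j + su3_gen j ** su3_gen i
      = mat (if i = j then 1 / 3 else 0) + (\<Sum>k\<in>UNIV. d i j k *\<^sub>R su3_gen k)"
proof (rule ex_ex1I)
  let ?A = "\<lambda>i j. su3_gen i ** su3_gen j + su3_gen j ** su3_gen i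
    - mat (if i = j then 1 / 3 else 0)"
  have *: "?A i j = (\<Sum>k\<in>UNIV. Re (trace (?A i j ** gell_mann k)) *\<^sub>R su3_gen k)" for i j
  proof (rule su3_expansion)
    show "cnj (?A i j $ a $ b) = ?A i j $ b $ a" for a b
      by (simp add: mat_def cnj_mult_su3_gen)
    have "trace (?A i j) = trace (su3_gen i ** su3_gen j) + trace (su3_gen j ** su3_gen i)
        - (if i = j then 1 else 0)"
      unfolding trace_def by (simp add: sum_3 mat_def)
    then show "trace (?A i j) = 0" by (simp add: trace_su3_gen_mult)
  qed
  show "\<exists>d. \<forall>i j. su3_gen i ** su3_gen j + su3_gen j ** su3_gen i
      = mat (if i = j then 1 / 3 else 0) + (\<Sum>k\<in>UNIV. d i j k *\<^sub>R su3_gen k)"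
    by (rule exI, intro allI, rule diff_eq_swap[OF *])
next
  fix f g :: "8 \<Rightarrow> 8 \<Rightarrow> 8 \<Rightarrow> real"
  assume f: "\<forall>i j. su3_gen i ** su3_gen j + su3_gen j ** su3_gen i
      = mat (if i = j then 1 / 3 else 0) + (\<Sum>k\<in>UNIV. f i j k *\<^sub>R su3_gen k)"
    and g: "\<forall>i j. su3_gen i ** su3_gen j + su3_gen j ** su3_gen i
      = mat (if i = j then 1 / 3 else 0) + (\<Sum>k\<in>UNIV. g i j k *\<^sub>R su3_gen k)"
  have "f i j = g i j" for i j
    by (rule su3_coeff_unique, rule add_left_imp_eq,
        rule trans[OF f[rule_format, symmetric] g[rule_format]])
  then show "f = g" by blast
qed

lemma su3_f_commutator:
  "su3_gen i ** su3_gen j - su3_gen j ** su3_gen i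
     = mat \<i> ** (\<Sum>k\<in>UNIV. su3_f i j k *\<^sub>R su3_gen k)"
  using theI'[OF su3_f_ex1] unfolding su3_f_def by blast

lemma su3_d_anticommutator:
  "su3_gen i ** su3_gen j + su3_gen j ** su3_gen i
     = mat (if i = j then 1 / 3 else 0) + (\<Sum>k\<in>UNIV. su3_d i j k *\<^sub>R su3_gen k)"
  using theI'[OF su3_d_ex1] unfolding su3_d_def by blast


section \<open>Three Higgs doublets, bilinears and the potential\<close>

text \<open>\<open>\<phi> $ a $ s\<close> is component \<open>s\<close> of the doublet number \<open>a\<close>.\<close>

type_synonym doublets = "complex^2^3"

definition doublet_prod :: "doublets \<Rightarrow> 3 \<Rightarrow> 3 \<Rightarrow> complex" where
  "doublet_prod \<phi> a b = (\<Sum>s\<in>UNIV. cnj (\<phi> $ a $ s) * \<phi> $ b $ s)"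

definition renormalizable_potential :: "(doublets \<Rightarrow> real) \<Rightarrow> bool" where
  "renormalizable_potential V \<longleftrightarrow>
    (\<exists>(Y :: 3 \<Rightarrow> 3 \<Rightarrow> complex) (Z :: 3 \<Rightarrow> 3 \<Rightarrow> 3 \<Rightarrow> 3 \<Rightarrow> complex). \<forall>\<phi>.
       complex_of_real (V \<phi>)
         = (\<Sum>a\<in>UNIV. \<Sum>b\<in>UNIV. Y a b * doublet_prod \<phi> a b)
           + (\<Sum>a\<in>UNIV. \<Sum>b\<in>UNIV. \<Sum>c\<in>UNIV. \<Sum>d\<in>UNIV.
                Z a b c d * doublet_prod \<phi> a b * doublet_prod \<phi> c d))"

text \<open>The sums under \<^const>\<open>Re\<close> in the bilinears are real (see the two lemmas below).\<close>

definition bilin0 :: "doublets \<Rightarrow> real" where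
  "bilin0 \<phi> = 1 / sqrt 3 * Re (\<Sum>a\<in>UNIV. doublet_prod \<phi> a a)"

definition bilin :: "doublets \<Rightarrow> real^8" where
  "bilin \<phi> = (\<chi> i. Re (\<Sum>a\<in>UNIV. \<Sum>b\<in>UNIV. doublet_prod \<phi> a b * su3_gen i $ a $ b))"

lemma cnj_doublet_prod: "cnj (doublet_prod \<phi> a b) = doublet_prod \<phi> b a"
  by (simp add: doublet_prod_def mult.commute)

lemma complex_of_real_bilin0:
  "complex_of_real (bilin0 \<phi>) = complex_of_real (1 / sqrt 3) * (\<Sum>a\<in>UNIV. doublet_prod \<phi> a a)"
proof -
  have "cnj (\<Sum>a\<in>UNIV. doublet_prod \<phi> a a) = (\<Sum>a\<in>UNIV. doublet_prod \<phi> a a)"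
    by (simp add: cnj_doublet_prod)
  then have "complex_of_real (Re (\<Sum>a\<in>UNIV. doublet_prod \<phi> a a)) = (\<Sum>a\<in>UNIV. doublet_prod \<phi> a a)"
    by (metis Reals_cnj_iff of_real_Re)
  then show ?thesis by (simp only: bilin0_def of_real_mult)
qed

lemma complex_of_real_bilin:
  "complex_of_real (bilin \<phi> $ i) = (\<Sum>a\<in>UNIV. \<Sum>b\<in>UNIV. doublet_prod \<phi> a b * su3_gen i $ a $ b)"
proof -
  have "cnj (\<Sum>a\<in>UNIV. \<Sum>b\<in>UNIV. doublet_prod \<phi> a b * su3_gen i $ a $ b)
      = (\<Sum>a\<in>UNIV. \<Sum>b\<in>UNIV. doublet_prod \<phi> a b * su3_gen i $ a $ b)"
    by (simp add: cnj_doublet_prod su3_gen_hermitian) (subst sum.swap, simp)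
  then show ?thesis
    unfolding bilin_def by (metis (no_types, lifting) Reals_cnj_iff of_real_Re vec_lambda_beta)
qed

definition bilinear_potential ::
    "real \<Rightarrow> real^8 \<Rightarrow> real \<Rightarrow> real^8 \<Rightarrow> real^8^8 \<Rightarrow> doublets \<Rightarrow> real" where
  "bilinear_potential M\<^sub>0 M \<Lambda>\<^sub>0 L \<Lambda> \<phi> =
     M\<^sub>0 * bilin0 \<phi> + (\<Sum>i\<in>UNIV. M $ i * bilin \<phi> $ i)
     + \<Lambda>\<^sub>0 * (bilin0 \<phi>)\<^sup>2 + (\<Sum>i\<in>UNIV. L $ i * bilin0 \<phi> * bilin \<phi> $ i)
     + (\<Sum>i\<in>UNIV. \<Sum>j\<in>UNIV. \<Lambda> $ i $ j * bilin \<phi> $ i * bilin \<phi> $ j)"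


section \<open>CP transformations of order 4\<close>

definition cp_transform :: "complex^3^3 \<Rightarrow> doublets \<Rightarrow> doublets" where
  "cp_transform X \<phi> = (\<chi> a s. \<Sum>b\<in>UNIV. X $ a $ b * cnj (\<phi> $ b $ s))"

definition cp_symmetry :: "complex^3^3 \<Rightarrow> (doublets \<Rightarrow> real) \<Rightarrow> bool" where
  "cp_symmetry X V \<longleftrightarrow> unitary_matrix X \<and> (\<forall>\<phi>. V (cp_transform X \<phi>) = V \<phi>)"

definition cp_order_4 :: "complex^3^3 \<Rightarrow> bool" where
  "cp_order_4 X \<longleftrightarrow> X ** cnj_matrix X \<noteq> mat 1
     \<and> (X ** cnj_matrix X) ** (X ** cnj_matrix X) = mat 1"

definition has_CP4_symmetry :: "(doublets \<Rightarrow> real) \<Rightarrow> bool" where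
  "has_CP4_symmetry V \<longleftrightarrow> (\<exists>X. cp_symmetry X V \<and> cp_order_4 X)"


section \<open>Conditions in the adjoint space\<close>

definition eigenvector_of :: "real^'n^'n \<Rightarrow> real^'n \<Rightarrow> bool" where
  "eigenvector_of A v \<longleftrightarrow> v \<noteq> 0 \<and> (\<exists>c. A *v v = c *\<^sub>R v)"

definition parallel_to :: "real^'n \<Rightarrow> real^'n \<Rightarrow> bool" where
  "parallel_to w v \<longleftrightarrow> (\<exists>c. w = c *\<^sub>R v)"

definition d_contract :: "real^8^8 \<Rightarrow> real^8" where
  "d_contract A = (\<chi> i. \<Sum>j\<in>UNIV. \<Sum>k\<in>UNIV. su3_d i j k * A $ j $ k)"

definition self_aligned :: "real^8 \<Rightarrow> bool" where
  "self_aligned v \<longleftrightarrow>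
     parallel_to (\<chi> i. \<Sum>j\<in>UNIV. \<Sum>k\<in>UNIV. su3_d i j k * v $ j * v $ k) v"

definition f_orthogonal :: "real^8 \<Rightarrow> real^8 \<Rightarrow> bool" where
  "f_orthogonal v w \<longleftrightarrow> (\<forall>i. (\<Sum>j\<in>UNIV. \<Sum>k\<in>UNIV. su3_f i j k * v $ j * w $ k) = 0)"

definition f_orthogonal_eigenvectors :: "real^8^8 \<Rightarrow> real^8 \<Rightarrow> (real^8) set \<Rightarrow> bool" where
  "f_orthogonal_eigenvectors \<Lambda> v S \<longleftrightarrow> pairwise orthogonal S
     \<and> (\<forall>w\<in>S. eigenvector_of \<Lambda> w \<and> orthogonal w v \<and> f_orthogonal v w)"

end

(*
  Idea. On the traceless Hermitian matrices v.t a unitary basis change acts by U^* A U and a CP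
  transformation by (X^* A X)^T; both preserve the Jordan product, hence the metric and d.
  Self-alignment of v8 means that v8.t has only two distinct eigenvalues, so after a basis change
  v8 is proportional to e8 and its f-orthogonal complement is the span of e1, e2, e3. For a CP4
  transformation X, the matrix X X^* is an involution of determinant 1 and plays the role of
  v8.t; in its eigenframe X acts on the bilinears as diag(-1, -1, -1, J, 1) with J^2 = -1 and J
  determined up to a rotation angle. Hence conditions (1) and (2) say that Lambda is block diagonal,
  and what remains is to find an angle for which J commutes with the block B on e4, ..., e7. That
  block is b0 plus nine components on products of left and right quaternion units. K || e8 removes
  three of them, leaving two vectors in R^3, and K^(2) || e8 says that these two are parallel, which
  is exactly the existence of such a J.
*)

theory Submission
  imports Defs
begin

section \<open>Matrix algebra\<close>

text \<open>The obstacle in the forward direction is that invariance of V concerns a function, while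
  the conditions concern M, L and Lambda. Each doublet has only two components, so the 3x3 matrix of
  doublet products is always singular and the bilinears do not fill R^9. This constraint is cubic
  whereas V is quadratic in the bilinears; in the proof this shows as the freedom to choose the two
  columns of the doublet matrix independently and to polarize. Once the coefficients are known to be
  invariant, the conditions follow from eigenspaces alone: the vectors fixed by X are exactly the
  multiples of e8, the negated ones exactly the f-orthogonal complement, and everything in the
  conditions is built equivariantly. The converse needs actual components of d, but only those along
  e1, e2, e3. It also has to choose a CP4 transformation, so the phases of its normal form are kept
  instead of being absorbed into the basis.\<close>

text \<open>Rectangular, because it is applied to the 3x2 matrix of the doublets as well; every
  bilinear is then a trace of \<open>dagger \<phi> ** A ** \<phi>\<close>.\<close>

definition dagger :: "complex^'n^'m \<Rightarrow> complex^'m^'n" where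
  "dagger A = transpose (cnj_matrix A)"

lemma dagger_entry: "dagger A $ a $ b = cnj (A $ b $ a)"
  by (simp add: dagger_def transpose_def cnj_matrix_def)

lemma cnj_matrix_entry: "cnj_matrix A $ a $ b = cnj (A $ a $ b)"
  by (simp add: cnj_matrix_def)

lemma transpose_entry: "transpose A $ a $ b = A $ b $ a"
  by (simp add: transpose_def)

lemma unitary_matrix_iff: "unitary_matrix U \<longleftrightarrow> dagger U ** U = mat 1 \<and> U ** dagger U = mat 1"
  by (simp add: unitary_matrix_def dagger_def)

lemma cnj_matrix_mult: "cnj_matrix (A ** B) = cnj_matrix A ** cnj_matrix B"
  by (simp add: vec_eq_iff cnj_matrix_def matrix_matrix_mult_def)

lemma cnj_matrix_cnj_matrix [simp]: "cnj_matrix (cnj_matrix A) = A"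
  by (simp add: vec_eq_iff cnj_matrix_def)

lemma dagger_dagger [simp]: "dagger (dagger A) = A"
  by (simp add: vec_eq_iff dagger_entry)

lemma dagger_mult: "dagger (A ** B) = dagger B ** dagger A"
  by (simp add: dagger_def cnj_matrix_mult matrix_transpose_mul)

lemma cnj_matrix_mat_1 [simp]: "cnj_matrix (mat 1) = mat 1"
  by (simp add: vec_eq_iff cnj_matrix_def mat_def)

lemma trace_cyclic: "trace (A ** B ** C) = trace (B ** C ** A)" for A B C :: "complex^'n^'n"
  using trace_mul_sym[of A "B ** C"] by (simp add: matrix_mul_assoc)

lemma trace_transpose: "trace (transpose A) = trace (A :: complex^'n^'n)"
  by (simp add: trace_def transpose_def)

section \<open>Real 8-vectors as traceless Hermitian matrices\<close>

definition su3_mat :: "real^8 \<Rightarrow> complex^3^3" where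
  "su3_mat v = (\<Sum>k\<in>UNIV. v $ k *\<^sub>R su3_gen k)"

text \<open>The Gell-Mann matrices are twice the generators and hence dual to them for the trace
  form, so these are the coordinates with respect to \<open>su3_gen\<close>.\<close>

definition su3_vec :: "complex^3^3 \<Rightarrow> real^8" where
  "su3_vec A = (\<chi> k. Re (trace (A ** gell_mann k)))"

lemma su3_vec_su3_mat [simp]: "su3_vec (su3_mat v) = v"
  by (simp add: su3_vec_def su3_mat_def su3_coeff vec_eq_iff)

lemma su3_mat_inject [simp]: "su3_mat v = su3_mat w \<longleftrightarrow> v = w"
  by (metis su3_vec_su3_mat)

lemma su3_mat_su3_vec:
  assumes "dagger A = A" "trace A = 0"
  shows "su3_mat (su3_vec A) = A"
proof -
  have "cnj (A $ a $ b) = A $ b $ a" for a b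
    by (metis assms(1) dagger_entry)
  from su3_expansion[OF this assms(2)] show ?thesis
    by (simp add: su3_mat_def su3_vec_def)
qed

lemma su3_mat_add: "su3_mat (v + w) = su3_mat v + su3_mat w"
  by (simp add: su3_mat_def scaleR_left_distrib sum.distrib)

lemma su3_mat_scaleR: "su3_mat (c *\<^sub>R v) = c *\<^sub>R su3_mat v"
  by (simp add: su3_mat_def scaleR_sum_right)

lemma su3_mat_0 [simp]: "su3_mat 0 = 0"
  by (simp add: su3_mat_def)

lemma su3_mat_entries:
  "su3_mat v $ 1 $ 1 = Complex ((v $ 3 + v $ 8 / sqrt 3) / 2) 0"
  "su3_mat v $ 1 $ 2 = Complex (v $ 1 / 2) (- v $ 2 / 2)"
  "su3_mat v $ 1 $ 3 = Complex (v $ 4 / 2) (- v $ 5 / 2)"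
  "su3_mat v $ 2 $ 1 = Complex (v $ 1 / 2) (v $ 2 / 2)"
  "su3_mat v $ 2 $ 2 = Complex ((- v $ 3 + v $ 8 / sqrt 3) / 2) 0"
  "su3_mat v $ 2 $ 3 = Complex (v $ 6 / 2) (- v $ 7 / 2)"
  "su3_mat v $ 3 $ 1 = Complex (v $ 4 / 2) (v $ 5 / 2)"
  "su3_mat v $ 3 $ 2 = Complex (v $ 6 / 2) (v $ 7 / 2)"
  "su3_mat v $ 3 $ 3 = Complex (- v $ 8 / sqrt 3) 0"
  by (simp_all add: su3_mat_def sum_8 su3_gen_def gell_mann_def complex_eq_iff)

lemma dagger_su3_mat [simp]: "dagger (su3_mat v) = su3_mat v"
  by (simp add: vec_eq_iff dagger_entry forall_3 su3_mat_entries complex_eq_iff)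

lemma trace_su3_mat [simp]: "trace (su3_mat v) = 0"
  by (simp add: trace_def sum_3 su3_mat_entries complex_eq_iff field_simps)

lemma su3_mat_axis: "su3_mat (axis k 1) = su3_gen k"
  by (simp add: su3_mat_def axis_def if_distrib[of "\<lambda>c. c *\<^sub>R _"] cong: if_cong)

lemma su3_mat_entry: "su3_mat v $ a $ b = (\<Sum>k\<in>UNIV. of_real (v $ k) * su3_gen k $ a $ b)"
  by (simp add: su3_mat_def scaleR_conv_of_real[where 'a = complex])

section \<open>The tensors as products on the adjoint space\<close>

text \<open>The free index is the last one, as in the anticommutation relation;
  \<open>self_aligned\<close> and \<open>d_contract\<close> leave the first one free, and
  \<open>su3_d_cyclic\<close> mediates.\<close>

definition d_prod :: "real^8 \<Rightarrow> real^8 \<Rightarrow> real^8" where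
  "d_prod v w = (\<chi> k. \<Sum>i\<in>UNIV. \<Sum>j\<in>UNIV. su3_d i j k * v $ i * w $ j)"

lemma su3_mat_mult_entry:
  "(su3_mat v ** su3_mat w) $ a $ b
   = (\<Sum>i\<in>UNIV. \<Sum>j\<in>UNIV. of_real (v $ i * w $ j) * (su3_gen i ** su3_gen j) $ a $ b)"
proof -
  have "(su3_mat v ** su3_mat w) $ a $ b
    = (\<Sum>c\<in>UNIV. \<Sum>i\<in>UNIV. \<Sum>j\<in>UNIV. of_real (v $ i * w $ j) * (su3_gen i $ a $ c * su3_gen j $ c $ b))"
    by (simp add: matrix_matrix_mult_def su3_mat_entry sum_product algebra_simps)
  also have "\<dots> = (\<Sum>i\<in>UNIV. \<Sum>c\<in>UNIV. \<Sum>j\<in>UNIV. of_real (v $ i * w $ j) * (su3_gen i $ a $ c * su3_gen j $ c $ b))"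
    by (rule sum.swap)
  also have "\<dots> = (\<Sum>i\<in>UNIV. \<Sum>j\<in>UNIV. \<Sum>c\<in>UNIV. of_real (v $ i * w $ j) * (su3_gen i $ a $ c * su3_gen j $ c $ b))"
    by (rule sum.cong[OF refl], rule sum.swap)
  finally show ?thesis by (simp add: matrix_matrix_mult_def sum_distrib_left)
qed

lemma su3_mat_mult_entry_swap:
  "(su3_mat w ** su3_mat v) $ a $ b
   = (\<Sum>i\<in>UNIV. \<Sum>j\<in>UNIV. of_real (v $ i * w $ j) * (su3_gen j ** su3_gen i) $ a $ b)"
  unfolding su3_mat_mult_entry by (subst sum.swap) (simp add: mult.commute)

text \<open>The defining relation of d, extended bilinearly. It splits the Jordan product into the
  metric (scalar part) and d (traceless part), so that preserving the Jordan product preserves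
  both.\<close>

lemma su3_mat_anticommutator:
  "su3_mat v ** su3_mat w + su3_mat w ** su3_mat v = mat (of_real (v \<bullet> w / 3)) + su3_mat (d_prod v w)"
proof -
  have "(su3_mat v ** su3_mat w + su3_mat w ** su3_mat v) $ a $ b
      = (mat (of_real (v \<bullet> w / 3)) + su3_mat (d_prod v w)) $ a $ b" for a b
  proof -
    have "(su3_mat v ** su3_mat w + su3_mat w ** su3_mat v) $ a $ b
      = (\<Sum>i\<in>UNIV. \<Sum>j\<in>UNIV. of_real (v $ i * w $ j) * (su3_gen i ** su3_gen j) $ a $ b)
      + (\<Sum>i\<in>UNIV. \<Sum>j\<in>UNIV. of_real (v $ i * w $ j) * (su3_gen j ** su3_gen i) $ a $ b)"
      by (simp only: vector_add_component su3_mat_mult_entry[of v w] su3_mat_mult_entry_swap[of w v])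
    also have "\<dots> = (\<Sum>i\<in>UNIV. \<Sum>j\<in>UNIV. of_real (v $ i * w $ j) *
        (su3_gen i ** su3_gen j + su3_gen j ** su3_gen i) $ a $ b)"
      by (simp add: sum.distrib distrib_left)
    also have "\<dots> = (\<Sum>i\<in>UNIV. \<Sum>j\<in>UNIV. of_real (v $ i * w $ j) *
        (mat (if i = j then 1/3 else 0) $ a $ b + (\<Sum>k\<in>UNIV. of_real (su3_d i j k) * su3_gen k $ a $ b)))"
      by (simp add: su3_d_anticommutator scaleR_conv_of_real[where 'a = complex])
    also have "\<dots> = (\<Sum>i\<in>UNIV. \<Sum>j\<in>UNIV. of_real (v $ i * w $ j) * mat (if i = j then 1/3 else 0) $ a $ b)
       + (\<Sum>i\<in>UNIV. \<Sum>j\<in>UNIV. \<Sum>k\<in>UNIV. of_real (su3_d i j k * v $ i * w $ j) * su3_gen k $ a $ b)"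
      by (simp add: distrib_left sum.distrib sum_distrib_left ac_simps)
    also have "(\<Sum>i\<in>UNIV. \<Sum>j\<in>UNIV. of_real (v $ i * w $ j) * mat (if i = j then 1/3 else 0) $ a $ b)
       = (mat (of_real (v \<bullet> w / 3)) :: complex^3^3) $ a $ b"
    proof -
      have "of_real (v $ i * w $ j) * (mat (if i = j then 1/3 else 0) :: complex^3^3) $ a $ b
        = (if j = i then (if a = b then of_real (v $ i * w $ i) / 3 else 0) else 0)" for i j
        by (auto simp: mat_def)
      then show ?thesis
        by (simp add: mat_def inner_vec_def sum_divide_distrib)
    qed
    also have "(\<Sum>i\<in>UNIV. \<Sum>j\<in>UNIV. \<Sum>k\<in>UNIV. of_real (su3_d i j k * v $ i * w $ j) * su3_gen k $ a $ b)
       = (\<Sum>i\<in>UNIV. \<Sum>k\<in>UNIV. \<Sum>j\<in>UNIV. of_real (su3_d i j k * v $ i * w $ j) * su3_gen k $ a $ b)"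
      by (rule sum.cong[OF refl], rule sum.swap)
    also have "\<dots> = (\<Sum>k\<in>UNIV. \<Sum>i\<in>UNIV. \<Sum>j\<in>UNIV. of_real (su3_d i j k * v $ i * w $ j) * su3_gen k $ a $ b)"
      by (rule sum.swap)
    also have "\<dots> = su3_mat (d_prod v w) $ a $ b"
      by (simp add: su3_mat_entry d_prod_def sum_distrib_right)
    finally show ?thesis by simp
  qed
  then show ?thesis by (simp add: vec_eq_iff)
qed

lemma trace_mat_3: "trace (mat c :: complex^3^3) = 3 * c"
  by (simp add: trace_def mat_def)

lemma trace_su3_mat_mult: "trace (su3_mat v ** su3_mat w) = of_real (v \<bullet> w) / 2"
proof -
  have "trace (su3_mat v ** su3_mat w + su3_mat w ** su3_mat v) = of_real (v \<bullet> w)"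
    by (simp add: su3_mat_anticommutator trace_add trace_mat_3)
  then show ?thesis using trace_mul_sym[of "su3_mat v" "su3_mat w"] by (simp add: trace_add field_simps)
qed

text \<open>The trilinear form of d is a symmetrized trace; the cyclic symmetry of d is thereby
  inherited from the trace.\<close>

lemma d_prod_inner:
  "of_real (d_prod v w \<bullet> u) = 2 * trace (su3_mat v ** su3_mat w ** su3_mat u)
      + 2 * trace (su3_mat w ** su3_mat v ** su3_mat u)"
proof -
  have "of_real (d_prod v w \<bullet> u) = 2 * trace (su3_mat (d_prod v w) ** su3_mat u)"
    by (simp add: trace_su3_mat_mult)
  also have "su3_mat (d_prod v w) = su3_mat v ** su3_mat w + su3_mat w ** su3_mat v - mat (of_real (v \<bullet> w / 3))"
    by (simp add: su3_mat_anticommutator)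
  also have "trace (\<dots> ** su3_mat u) = trace (su3_mat v ** su3_mat w ** su3_mat u)
      + trace (su3_mat w ** su3_mat v ** su3_mat u) - of_real (v \<bullet> w / 3) * trace (su3_mat u)"
    by (simp add: trace_def matrix_matrix_mult_def sum_3 mat_def algebra_simps)
  finally show ?thesis by simp
qed

lemma d_prod_inner_cyclic: "d_prod v w \<bullet> u = d_prod w u \<bullet> v"
proof -
  have "trace (su3_mat v ** su3_mat w ** su3_mat u) = trace (su3_mat w ** su3_mat u ** su3_mat v)"
    and "trace (su3_mat w ** su3_mat v ** su3_mat u) = trace (su3_mat u ** su3_mat w ** su3_mat v)"
    by (metis trace_cyclic)+
  then have "complex_of_real (d_prod v w \<bullet> u) = of_real (d_prod w u \<bullet> v)"
    by (simp add: d_prod_inner)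
  then show ?thesis by (simp only: of_real_eq_iff)
qed

lemma d_prod_axis: "d_prod (axis i 1) (axis j 1) $ k = su3_d i j k"
proof -
  have "su3_d i' j' k * axis i 1 $ i' * axis j 1 $ j' = (if j' = j then if i' = i then su3_d i' j' k else 0 else 0)" for i' j'
    by (simp add: axis_def)
  then show ?thesis by (simp add: d_prod_def)
qed

lemma su3_d_cyclic: "su3_d i j k = su3_d j k i"
  using d_prod_inner_cyclic[of "axis i 1" "axis j 1" "axis k 1"]
  by (simp add: inner_axis d_prod_axis)

lemma self_aligned_d_prod: "self_aligned v \<longleftrightarrow> parallel_to (d_prod v v) v"
  by (simp add: self_aligned_def d_prod_def su3_d_cyclic[symmetric])

section \<open>The commutator and f-orthogonality\<close>

lemma su3_mat_commutator:
  "su3_mat v ** su3_mat w - su3_mat w ** su3_mat v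
   = mat \<i> ** su3_mat (\<chi> k. \<Sum>i\<in>UNIV. \<Sum>j\<in>UNIV. su3_f i j k * v $ i * w $ j)" (is "_ = mat \<i> ** su3_mat ?c")
proof -
  have "(su3_mat v ** su3_mat w - su3_mat w ** su3_mat v) $ a $ b
      = (mat \<i> ** su3_mat ?c) $ a $ b" for a b
  proof -
    have "(su3_mat v ** su3_mat w - su3_mat w ** su3_mat v) $ a $ b
      = (\<Sum>i\<in>UNIV. \<Sum>j\<in>UNIV. of_real (v $ i * w $ j) * (su3_gen i ** su3_gen j) $ a $ b)
      - (\<Sum>i\<in>UNIV. \<Sum>j\<in>UNIV. of_real (v $ i * w $ j) * (su3_gen j ** su3_gen i) $ a $ b)"
      by (simp only: vector_minus_component su3_mat_mult_entry[of v w] su3_mat_mult_entry_swap[of w v])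
    also have "\<dots> = (\<Sum>i\<in>UNIV. \<Sum>j\<in>UNIV. of_real (v $ i * w $ j) *
        (su3_gen i ** su3_gen j - su3_gen j ** su3_gen i) $ a $ b)"
      by (simp add: sum_subtractf right_diff_distrib)
    also have "\<dots> = (\<Sum>i\<in>UNIV. \<Sum>j\<in>UNIV. of_real (v $ i * w $ j) *
        (\<i> * (\<Sum>k\<in>UNIV. of_real (su3_f i j k) * su3_gen k $ a $ b)))"
      by (simp only: su3_f_commutator mat_mult_entry)
         (simp add: scaleR_conv_of_real[where 'a = complex])
    also have "\<dots> = \<i> * (\<Sum>i\<in>UNIV. \<Sum>j\<in>UNIV. \<Sum>k\<in>UNIV. of_real (su3_f i j k * v $ i * w $ j) * su3_gen k $ a $ b)"
      by (simp add: sum_distrib_left ac_simps)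
    also have "(\<Sum>i\<in>UNIV. \<Sum>j\<in>UNIV. \<Sum>k\<in>UNIV. of_real (su3_f i j k * v $ i * w $ j) * su3_gen k $ a $ b)
       = (\<Sum>i\<in>UNIV. \<Sum>k\<in>UNIV. \<Sum>j\<in>UNIV. of_real (su3_f i j k * v $ i * w $ j) * su3_gen k $ a $ b)"
      by (rule sum.cong[OF refl], rule sum.swap)
    also have "\<dots> = (\<Sum>k\<in>UNIV. \<Sum>i\<in>UNIV. \<Sum>j\<in>UNIV. of_real (su3_f i j k * v $ i * w $ j) * su3_gen k $ a $ b)"
      by (rule sum.swap)
    also have "\<i> * \<dots> = \<i> * su3_mat ?c $ a $ b"
      by (simp add: su3_mat_entry sum_distrib_right)
    finally show ?thesis by (simp add: mat_mult_entry)
  qed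
  then show ?thesis by (simp add: vec_eq_iff)
qed

text \<open>Pairing the commutator with \<open>su3_gen k\<close> isolates one coefficient; the
  factor is the inverse of i/2, where 1/2 is the trace norm of a generator.\<close>

lemma su3_f_trace: "of_real (su3_f i j k)
   = - 2 * \<i> * trace ((su3_gen i ** su3_gen j - su3_gen j ** su3_gen i) ** su3_gen k)"
proof -
  let ?v = "(\<chi> l. su3_f i j l) :: real^8"
  have "su3_gen i ** su3_gen j - su3_gen j ** su3_gen i = mat \<i> ** su3_mat ?v"
    by (simp add: su3_f_commutator su3_mat_def)
  then have "(su3_gen i ** su3_gen j - su3_gen j ** su3_gen i) ** su3_gen k
     = mat \<i> ** (su3_mat ?v ** su3_mat (axis k 1))"
    by (simp add: su3_mat_axis matrix_mul_assoc)
  moreover have "trace (mat \<i> ** A) = \<i> * trace A" for A :: "complex^3^3"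
    by (simp add: trace_def mat_mult_entry sum_distrib_left)
  ultimately show ?thesis by (simp add: trace_su3_mat_mult inner_axis)
qed

lemma matrix_diff_rdistrib: "((A :: complex^3^3) - B) ** (C :: complex^3^3) = A ** C - B ** C"
  by (simp add: matrix_matrix_mult_def vec_eq_iff left_diff_distrib sum_subtractf)

lemma su3_f_cyclic: "su3_f i j k = su3_f j k i"
proof -
  have "trace ((A ** B - B ** A) ** C) = trace ((B ** C - C ** B) ** A)" for A B C :: "complex^3^3"
    using trace_cyclic[of A B C] trace_cyclic[of C B A]
    by (simp add: matrix_diff_rdistrib trace_sub)
  then have "complex_of_real (su3_f i j k) = of_real (su3_f j k i)"
    by (simp add: su3_f_trace)
  then show ?thesis by (simp only: of_real_eq_iff)
qed

text \<open>Since f collects the structure constants, contracting it with two vectors gives the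
  coordinates of their commutator. From here on f enters only through commuting matrices.\<close>

lemma f_orthogonal_commute:
  "f_orthogonal v w \<longleftrightarrow> su3_mat v ** su3_mat w = su3_mat w ** su3_mat v"
proof -
  have "f_orthogonal v w \<longleftrightarrow> (\<chi> k. \<Sum>i\<in>UNIV. \<Sum>j\<in>UNIV. su3_f i j k * v $ i * w $ j) = 0" (is "_ \<longleftrightarrow> ?c = 0")
    by (simp add: f_orthogonal_def vec_eq_iff su3_f_cyclic[symmetric])
  also have "\<dots> \<longleftrightarrow> su3_mat ?c = 0" using su3_mat_inject[of ?c 0] by (simp only: su3_mat_0)
  also have "\<dots> \<longleftrightarrow> mat \<i> ** su3_mat ?c = 0"
    by (simp add: vec_eq_iff mat_mult_entry)
  also have "\<dots> \<longleftrightarrow> su3_mat v ** su3_mat w = su3_mat w ** su3_mat v"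
    by (simp add: su3_mat_commutator[symmetric])
  finally show ?thesis .
qed

section \<open>Linear maps preserving the metric and d\<close>

definition d_automorphism :: "real^8^8 \<Rightarrow> bool" where
  "d_automorphism Q \<longleftrightarrow> (\<forall>v w. (Q *v v) \<bullet> (Q *v w) = v \<bullet> w)
     \<and> (\<forall>v w. d_prod (Q *v v) (Q *v w) = Q *v d_prod v w)"

lemma d_automorphism_orthogonal:
  assumes "d_automorphism Q"
  shows "transpose Q ** Q = mat 1" "Q ** transpose Q = mat 1"
proof -
  have "orthogonal_transformation ((*v) Q)"
    using assms by (simp add: d_automorphism_def orthogonal_transformation_def)
  then have "orthogonal_matrix Q" by (simp add: orthogonal_transformation_matrix matrix_of_matrix_vector_mul)
  then show "transpose Q ** Q = mat 1" "Q ** transpose Q = mat 1"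
    by (simp_all add: orthogonal_matrix_def)
qed

definition d_matrix :: "real^8 \<Rightarrow> real^8^8" where
  "d_matrix u = (\<chi> k j. \<Sum>i\<in>UNIV. su3_d i j k * u $ i)"

lemma d_matrix_mult: "d_matrix u *v w = d_prod u w"
  by (simp add: d_matrix_def d_prod_def matrix_vector_mult_def vec_eq_iff sum_distrib_right)
     (auto intro: sum.swap)

text \<open>Tested against u, the contraction is the trace of A with the operator of
  d-multiplication by u; its covariance becomes invariance of a trace.\<close>

lemma d_contract_inner: "d_contract A \<bullet> u = trace (d_matrix u ** A)"
proof -
  have "d_contract A \<bullet> u = (\<Sum>i\<in>UNIV. \<Sum>j\<in>UNIV. \<Sum>k\<in>UNIV. su3_d i j k * u $ i * A $ j $ k)"
    by (simp add: d_contract_def inner_vec_def sum_distrib_right sum_distrib_left ac_simps)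
  also have "\<dots> = (\<Sum>j\<in>UNIV. \<Sum>i\<in>UNIV. \<Sum>k\<in>UNIV. su3_d i j k * u $ i * A $ j $ k)"
    by (rule sum.swap)
  also have "\<dots> = (\<Sum>j\<in>UNIV. \<Sum>k\<in>UNIV. \<Sum>i\<in>UNIV. su3_d i j k * u $ i * A $ j $ k)"
    by (rule sum.cong[OF refl], rule sum.swap)
  also have "\<dots> = (\<Sum>k\<in>UNIV. \<Sum>j\<in>UNIV. \<Sum>i\<in>UNIV. su3_d i j k * u $ i * A $ j $ k)"
    by (rule sum.swap)
  also have "\<dots> = trace (d_matrix u ** A)"
    by (simp add: trace_def matrix_matrix_mult_def d_matrix_def sum_distrib_right)
  finally show ?thesis .
qed

text \<open>An automorphism intertwines d-multiplication by u with d-multiplication by its image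
  (\<open>D\<close>), so the traces agree; the images exhaust the space, so testing against them
  suffices.\<close>

lemma d_contract_conjugate:
  assumes "d_automorphism Q"
  shows "d_contract (Q ** A ** transpose Q) = Q *v d_contract A"
proof -
  have D: "d_matrix (Q *v u) ** Q = Q ** d_matrix u" for u
    using assms by (simp add: matrix_eq matrix_vector_mul_assoc[symmetric] d_matrix_mult d_automorphism_def)
  have "d_contract (Q ** A ** transpose Q) \<bullet> (Q *v u) = (Q *v d_contract A) \<bullet> (Q *v u)" for u
  proof -
    have "d_contract (Q ** A ** transpose Q) \<bullet> (Q *v u) = trace (d_matrix (Q *v u) ** Q ** A ** transpose Q)"
      by (simp add: d_contract_inner matrix_mul_assoc)
    also have "\<dots> = trace (transpose Q ** Q ** (d_matrix u ** A))"
      using trace_mul_sym[of "Q ** (d_matrix u ** A)" "transpose Q"]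
      by (simp only: D) (simp only: matrix_mul_assoc)
    also have "\<dots> = d_contract A \<bullet> u"
      by (simp add: d_automorphism_orthogonal[OF assms] d_contract_inner)
    finally show ?thesis using assms by (simp add: d_automorphism_def)
  qed
  from this[of "transpose Q *v u" for u]
  have "\<forall>u. d_contract (Q ** A ** transpose Q) \<bullet> u = (Q *v d_contract A) \<bullet> u"
    by (simp only: matrix_vector_mul_assoc d_automorphism_orthogonal[OF assms] matrix_vector_mul_lid simp_thms)
  then show ?thesis by (simp only: vector_eq_rdot)
qed

text \<open>Apply g to the anticommutator identity: the trace compares the metrics, and what is left
  compares d. Using only the symmetrized product admits maps that reverse products, hence reverse f,
  as CP transformations do.\<close>

lemma su3_automorphism:
  fixes g :: "complex^3^3 \<Rightarrow> complex^3^3"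
  assumes add: "\<And>A B. g (A + B) = g A + g B"
    and scale: "\<And>c A. g (c *\<^sub>R A) = c *\<^sub>R g A"
    and herm: "\<And>A. dagger A = A \<Longrightarrow> dagger (g A) = g A"
    and trace: "\<And>A. trace (g A) = trace A"
    and jordan: "\<And>A B. g (A ** B + B ** A) = g A ** g B + g B ** g A"
    and unit: "\<And>c. g (mat c) = mat c"
  obtains Q where "d_automorphism Q" "\<And>v. su3_mat (Q *v v) = g (su3_mat v)"
proof
  let ?h = "\<lambda>v. su3_vec (g (su3_mat v))"
  let ?Q = "matrix ?h"
  have h: "su3_mat (?h v) = g (su3_mat v)" for v
    by (simp add: su3_mat_su3_vec herm trace)
  have "linear ?h"
  proof (rule linearI)
    show "?h (v + w) = ?h v + ?h w" for v w
      unfolding su3_mat_inject[symmetric] by (simp only: h) (simp only: su3_mat_add h add)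
    show "?h (c *\<^sub>R v) = c *\<^sub>R ?h v" for c v
      unfolding su3_mat_inject[symmetric] by (simp only: h) (simp only: su3_mat_scaleR h scale)
  qed
  then show Q: "su3_mat (?Q *v v) = g (su3_mat v)" for v
    by (simp add: h matrix_works)
  have *: "mat (of_real ((?Q *v v) \<bullet> (?Q *v w) / 3)) + su3_mat (d_prod (?Q *v v) (?Q *v w))
      = mat (of_real (v \<bullet> w / 3)) + su3_mat (?Q *v d_prod v w)" for v w
    by (simp only: su3_mat_anticommutator[symmetric] Q jordan[symmetric])
       (simp only: su3_mat_anticommutator add unit Q)
  have inner: "(?Q *v v) \<bullet> (?Q *v w) = v \<bullet> w" for v w
  proof -
    have "complex_of_real ((?Q *v v) \<bullet> (?Q *v w)) = of_real (v \<bullet> w)"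
      using arg_cong[OF *[of v w], of trace] by (simp add: trace_add trace_mat_3)
    then show ?thesis by (rule of_real_eq_iff[THEN iffD1])
  qed
  moreover have "d_prod (?Q *v v) (?Q *v w) = ?Q *v d_prod v w" for v w
    using *[of v w] unfolding inner by simp
  ultimately show "d_automorphism ?Q" by (simp add: d_automorphism_def)
qed

lemma matrix_mult_scaleR:
  fixes A :: "complex^'n^'m" and B :: "complex^'k^'n"
  shows "(c *\<^sub>R A) ** B = c *\<^sub>R (A ** B)" "A ** (c *\<^sub>R B) = c *\<^sub>R (A ** B)"
  by (simp_all add: matrix_matrix_mult_def vec_eq_iff scaleR_sum_right)

lemma matrix_add_rdistrib: "(A + B) ** C = A ** C + B ** C" for A B :: "complex^'n^'m"
  by (simp add: matrix_matrix_mult_def vec_eq_iff distrib_right sum.distrib)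

lemma mat_commute: "A ** mat c = mat c ** A" for A :: "complex^3^3"
  by (simp add: vec_eq_iff matrix_matrix_mult_def mat_def if_distrib if_distribR mult.commute cong: if_cong)

lemma unitary_conjugate_mult:
  fixes A B :: "complex^3^3"
  assumes "unitary_matrix U"
  shows "dagger U ** (A ** B) ** U = (dagger U ** A ** U) ** (dagger U ** B ** U)"
proof -
  have "(dagger U ** A ** U) ** (dagger U ** B ** U) = dagger U ** A ** (U ** dagger U) ** B ** U"
    by (simp only: matrix_mul_assoc)
  also have "\<dots> = dagger U ** (A ** B) ** U"
    using assms by (simp only: unitary_matrix_iff matrix_mul_rid matrix_mul_assoc)
  finally show ?thesis by simp
qed

lemma unitary_conjugate_trace:
  "unitary_matrix U \<Longrightarrow> trace (dagger U ** A ** U) = trace (A :: complex^3^3)"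
  using trace_cyclic[of "dagger U" A U] trace_mul_sym[of "A ** U" "dagger U"]
  by (simp add: unitary_matrix_iff matrix_mul_assoc[symmetric])

lemma unitary_conjugate_mat:
  "unitary_matrix U \<Longrightarrow> dagger U ** mat c ** U = (mat c :: complex^3^3)"
  by (simp only: mat_commute[of "dagger U"] matrix_mul_assoc[symmetric])
     (simp add: unitary_matrix_iff)

lemma unitary_automorphism:
  assumes "unitary_matrix U"
  obtains Q where "d_automorphism Q" "\<And>v. su3_mat (Q *v v) = dagger U ** su3_mat v ** U"
proof (rule su3_automorphism[of "\<lambda>A. dagger U ** A ** U"])
  show "dagger U ** (A + B) ** U = dagger U ** A ** U + dagger U ** B ** U" for A B
    by (simp add: matrix_add_ldistrib matrix_add_rdistrib)
  then show "dagger U ** (A ** B + B ** A) ** U = (dagger U ** A ** U) ** (dagger U ** B ** U)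
      + (dagger U ** B ** U) ** (dagger U ** A ** U)" for A B
    by (simp add: unitary_conjugate_mult[OF assms])
qed (simp_all add: assms matrix_mult_scaleR dagger_mult matrix_mul_assoc
    unitary_conjugate_trace unitary_conjugate_mat)

lemma transpose_add: "transpose (A + B) = transpose A + transpose B"
  by (simp add: vec_eq_iff transpose_def)

lemma dagger_transpose: "dagger (transpose A) = transpose (dagger A)"
  by (simp add: vec_eq_iff dagger_entry transpose_entry)

text \<open>Transposition reverses each product, which only exchanges the two summands of the Jordan
  product; the closing \<open>add.commute\<close> is this exchange.\<close>

lemma antiunitary_automorphism:
  assumes "unitary_matrix X"
  obtains Q where "d_automorphism Q" "\<And>v. su3_mat (Q *v v) = transpose (dagger X ** su3_mat v ** X)"
proof (rule su3_automorphism[of "\<lambda>A. transpose (dagger X ** A ** X)"])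
  show add: "transpose (dagger X ** (A + B) ** X) = transpose (dagger X ** A ** X) + transpose (dagger X ** B ** X)" for A B
    by (simp add: matrix_add_ldistrib matrix_add_rdistrib transpose_add)
  show "transpose (dagger X ** (A ** B + B ** A) ** X)
      = transpose (dagger X ** A ** X) ** transpose (dagger X ** B ** X)
      + transpose (dagger X ** B ** X) ** transpose (dagger X ** A ** X)" for A B
    unfolding add unitary_conjugate_mult[OF assms] matrix_transpose_mul[of "dagger X ** _ ** X"]
    by (rule add.commute)
qed (simp_all add: assms matrix_mult_scaleR dagger_mult matrix_mul_assoc dagger_transpose trace_transpose
    transpose_scalar unitary_conjugate_trace unitary_conjugate_mat)

lemma f_orthogonal_conjugate:
  assumes U: "unitary_matrix U" and Q: "\<And>v. su3_mat (Q *v v) = dagger U ** su3_mat v ** U"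
  shows "f_orthogonal (Q *v v) (Q *v w) \<longleftrightarrow> f_orthogonal v w"
proof -
  have "U ** (dagger U ** A ** U) ** dagger U = A" for A :: "complex^3^3"
  proof -
    have "U ** (dagger U ** A ** U) ** dagger U = (U ** dagger U) ** A ** (U ** dagger U)"
      by (simp only: matrix_mul_assoc)
    then show ?thesis using U by (simp add: unitary_matrix_iff)
  qed
  then have "dagger U ** A ** U = dagger U ** B ** U \<longleftrightarrow> A = B" for A B :: "complex^3^3"
    by metis
  then show ?thesis
    by (simp add: f_orthogonal_commute Q unitary_conjugate_mult[OF U, symmetric])
qed

section \<open>Bilinears under transformations of the doublets\<close>

lemma doublet_prod_sum:
  "(\<Sum>a\<in>UNIV. \<Sum>b\<in>UNIV. doublet_prod \<phi> a b * A $ a $ b) = trace (dagger \<phi> ** A ** \<phi>)"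
proof -
  have "(\<Sum>a\<in>UNIV. \<Sum>b\<in>UNIV. doublet_prod \<phi> a b * A $ a $ b)
     = (\<Sum>a\<in>UNIV. \<Sum>b\<in>UNIV. \<Sum>s\<in>UNIV. cnj (\<phi> $ a $ s) * A $ a $ b * \<phi> $ b $ s)"
    by (simp add: doublet_prod_def sum_distrib_right sum_distrib_left ac_simps)
  also have "\<dots> = (\<Sum>b\<in>UNIV. \<Sum>a\<in>UNIV. \<Sum>s\<in>UNIV. cnj (\<phi> $ a $ s) * A $ a $ b * \<phi> $ b $ s)"
    by (rule sum.swap)
  also have "\<dots> = (\<Sum>b\<in>UNIV. \<Sum>s\<in>UNIV. \<Sum>a\<in>UNIV. cnj (\<phi> $ a $ s) * A $ a $ b * \<phi> $ b $ s)"
    by (rule sum.cong[OF refl], rule sum.swap)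
  also have "\<dots> = (\<Sum>s\<in>UNIV. \<Sum>b\<in>UNIV. \<Sum>a\<in>UNIV. cnj (\<phi> $ a $ s) * A $ a $ b * \<phi> $ b $ s)"
    by (rule sum.swap)
  also have "\<dots> = trace (dagger \<phi> ** A ** \<phi>)"
    by (simp add: trace_def matrix_matrix_mult_def dagger_entry sum_distrib_right)
  finally show ?thesis .
qed

lemma bilin_inner: "of_real (bilin \<phi> \<bullet> v) = trace (dagger \<phi> ** su3_mat v ** \<phi>)"
proof -
  have "of_real (bilin \<phi> \<bullet> v) = (\<Sum>k\<in>UNIV. of_real (bilin \<phi> $ k) * of_real (v $ k) :: complex)"
    by (simp add: inner_vec_def)
  also have "\<dots> = (\<Sum>k\<in>UNIV. \<Sum>a\<in>UNIV. \<Sum>b\<in>UNIV. doublet_prod \<phi> a b * (of_real (v $ k) * su3_gen k $ a $ b))"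
    by (simp only: complex_of_real_bilin) (simp add: sum_distrib_right sum_distrib_left ac_simps)
  also have "\<dots> = (\<Sum>a\<in>UNIV. \<Sum>k\<in>UNIV. \<Sum>b\<in>UNIV. doublet_prod \<phi> a b * (of_real (v $ k) * su3_gen k $ a $ b))"
    by (rule sum.swap)
  also have "\<dots> = (\<Sum>a\<in>UNIV. \<Sum>b\<in>UNIV. \<Sum>k\<in>UNIV. doublet_prod \<phi> a b * (of_real (v $ k) * su3_gen k $ a $ b))"
    by (rule sum.cong[OF refl], rule sum.swap)
  also have "\<dots> = trace (dagger \<phi> ** su3_mat v ** \<phi>)"
    by (simp add: doublet_prod_sum[symmetric] su3_mat_entry sum_distrib_left)
  finally show ?thesis .
qed

lemma bilin0_trace: "of_real (bilin0 \<phi>) = of_real (1 / sqrt 3) * trace (dagger \<phi> ** \<phi>)"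
proof -
  have "(\<Sum>a\<in>UNIV. doublet_prod \<phi> a a) = (\<Sum>a\<in>UNIV. \<Sum>b\<in>UNIV. doublet_prod \<phi> a b * (mat 1 :: complex^3^3) $ a $ b)"
    by (simp add: mat_def if_distrib if_distribR cong: if_cong)
  then show ?thesis by (simp only: complex_of_real_bilin0 doublet_prod_sum matrix_mul_rid)
qed

lemma bilinear_potential_inner:
  "bilinear_potential m M l L A \<phi> = m * bilin0 \<phi> + M \<bullet> bilin \<phi> + l * (bilin0 \<phi>)\<^sup>2
     + bilin0 \<phi> * (L \<bullet> bilin \<phi>) + bilin \<phi> \<bullet> (A *v bilin \<phi>)"
  by (simp add: bilinear_potential_def inner_vec_def matrix_vector_mult_def sum_distrib_left algebra_simps)

lemma inner_transpose:
  fixes Q :: "real^'n^'m"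
  shows "x \<bullet> (transpose Q *v y) = (Q *v x) \<bullet> y" "(transpose Q *v y) \<bullet> x = y \<bullet> (Q *v x)"
  using dot_lmul_matrix[of y Q x] by (simp_all add: inner_commute)

text \<open>The bilinears transform with \<open>transpose Q\<close>, so by adjointness the
  coefficients transform with \<open>Q\<close>.\<close>

lemma bilinear_potential_transform:
  assumes "bilin0 \<psi> = bilin0 \<phi>" and "\<And>v. bilin \<psi> \<bullet> v = bilin \<phi> \<bullet> (Q *v v)"
  shows "bilinear_potential m M l L A \<psi>
    = bilinear_potential m (Q *v M) l (Q *v L) (Q ** A ** transpose Q) \<phi>"
proof -
  have "\<forall>v. bilin \<psi> \<bullet> v = (transpose Q *v bilin \<phi>) \<bullet> v"
    by (simp only: inner_transpose assms(2) simp_thms)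
  then have "bilin \<psi> = transpose Q *v bilin \<phi>"
    by (simp only: vector_eq_rdot)
  then show ?thesis
    by (simp only: bilinear_potential_inner assms(1) matrix_vector_mul_assoc[symmetric] inner_transpose)
qed

lemma bilin_unitary:
  assumes U: "unitary_matrix U" and Q: "\<And>v. su3_mat (Q *v v) = dagger U ** su3_mat v ** U"
  shows "bilin0 (U ** \<phi>) = bilin0 \<phi>" "bilin (U ** \<phi>) \<bullet> v = bilin \<phi> \<bullet> (Q *v v)"
proof -
  have "dagger (U ** \<phi>) ** (U ** \<phi>) = dagger \<phi> ** (dagger U ** U) ** \<phi>"
    by (simp only: dagger_mult matrix_mul_assoc)
  then have "complex_of_real (bilin0 (U ** \<phi>)) = of_real (bilin0 \<phi>)"
    using U by (simp add: bilin0_trace unitary_matrix_iff)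
  then show "bilin0 (U ** \<phi>) = bilin0 \<phi>" by (rule of_real_eq_iff[THEN iffD1])
  have "complex_of_real (bilin (U ** \<phi>) \<bullet> v) = of_real (bilin \<phi> \<bullet> (Q *v v))"
    by (simp add: bilin_inner Q dagger_mult matrix_mul_assoc)
  then show "bilin (U ** \<phi>) \<bullet> v = bilin \<phi> \<bullet> (Q *v v)" by (rule of_real_eq_iff[THEN iffD1])
qed

lemma cp_transform_mult: "cp_transform X \<phi> = X ** cnj_matrix \<phi>"
  by (simp add: cp_transform_def matrix_matrix_mult_def cnj_matrix_def vec_eq_iff)

lemma bilin_antiunitary:
  assumes X: "unitary_matrix X" and Q: "\<And>v. su3_mat (Q *v v) = transpose (dagger X ** su3_mat v ** X)"
  shows "bilin0 (cp_transform X \<phi>) = bilin0 \<phi>" "bilin (cp_transform X \<phi>) \<bullet> v = bilin \<phi> \<bullet> (Q *v v)"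
proof -
  \<comment> \<open>Transposing the 2x2 matrix under the trace moves the conjugation off the
    doublets and onto A as a transposition; this is why \<open>Q\<close> contains
    \<open>transpose\<close>.\<close>
  have tr: "trace (dagger (cnj_matrix \<phi>) ** A ** cnj_matrix \<phi>) = trace (dagger \<phi> ** transpose A ** \<phi>)" for A
  proof -
    have "transpose (dagger (cnj_matrix \<phi>) ** A ** cnj_matrix \<phi>) = dagger \<phi> ** transpose A ** \<phi>"
      by (simp add: matrix_transpose_mul dagger_def matrix_mul_assoc)
    then show ?thesis by (metis trace_transpose)
  qed
  have "dagger (X ** cnj_matrix \<phi>) ** (X ** cnj_matrix \<phi>) = dagger (cnj_matrix \<phi>) ** (dagger X ** X) ** cnj_matrix \<phi>"
    by (simp only: dagger_mult matrix_mul_assoc)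
  then have "complex_of_real (bilin0 (cp_transform X \<phi>)) = of_real (bilin0 \<phi>)"
    using X tr[of "mat 1"] by (simp add: bilin0_trace unitary_matrix_iff cp_transform_mult)
  then show "bilin0 (cp_transform X \<phi>) = bilin0 \<phi>" by (rule of_real_eq_iff[THEN iffD1])
  have "dagger (X ** cnj_matrix \<phi>) ** su3_mat v ** (X ** cnj_matrix \<phi>)
      = dagger (cnj_matrix \<phi>) ** (dagger X ** su3_mat v ** X) ** cnj_matrix \<phi>"
    by (simp only: dagger_mult matrix_mul_assoc)
  then have "complex_of_real (bilin (cp_transform X \<phi>) \<bullet> v) = of_real (bilin \<phi> \<bullet> (Q *v v))"
    by (simp add: bilin_inner Q cp_transform_mult tr)
  then show "bilin (cp_transform X \<phi>) \<bullet> v = bilin \<phi> \<bullet> (Q *v v)" by (rule of_real_eq_iff[THEN iffD1])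
qed

section \<open>Orthogonal eigenvectors of symmetric matrices\<close>

text \<open>A maximizer x of the Rayleigh quotient on the unit sphere of W is an eigenvector: the
  part y of A x orthogonal to x stays in W, and moving from x along y would raise the quotient to
  first order unless y = 0.\<close>

lemma symmetric_eigenvector_in_subspace:
  fixes A :: "real^'n^'n"
  assumes sym: "transpose A = A" and W: "subspace W" "W \<noteq> {0}"
    and inv: "\<And>w. w \<in> W \<Longrightarrow> A *v w \<in> W"
  obtains w where "w \<in> W" "eigenvector_of A w"
proof -
  let ?S = "W \<inter> sphere 0 1"
  let ?f = "\<lambda>x. x \<bullet> (A *v x)"
  have sym': "x \<bullet> (A *v y) = (A *v x) \<bullet> y" for x y
    using inner_transpose(1)[of x A y] sym by simp
  obtain u where u: "u \<in> W" "u \<noteq> 0" using W subspace_0 by blast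
  then have "u /\<^sub>R norm u \<in> ?S" using W by (simp add: subspace_scale)
  then have "?S \<noteq> {}" by blast
  moreover have "compact ?S"
    using W(1) by (simp add: closed_subspace closed_Int_compact)
  moreover have "continuous_on ?S ?f"
    by (intro continuous_intros matrix_vector_mult_linear_continuous_on)
  ultimately obtain x where x: "x \<in> ?S" and max: "\<And>y. y \<in> ?S \<Longrightarrow> ?f y \<le> ?f x"
    using continuous_attains_sup[of ?S ?f] by blast
  have xx: "x \<bullet> x = 1" using x by (simp add: dot_square_norm)
  define c where "c = ?f x"
  have le: "?f y \<le> c * (y \<bullet> y)" if "y \<in> W" for y
  proof (cases "y = 0")
    case False
    let ?z = "y /\<^sub>R norm y"
    have "?z \<in> ?S" using False that W by (simp add: subspace_scale)
    then have "?f ?z \<le> c" unfolding c_def by (rule max)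
    then have "?f y / (norm y * norm y) \<le> c"
      by (simp add: matrix_vector_mult_scaleR divide_inverse ac_simps)
    then show ?thesis using False by (simp add: divide_le_eq dot_square_norm power2_eq_square)
  qed simp
  define y where "y = A *v x - c *\<^sub>R x"
  have y: "y \<in> W" using x inv W by (simp add: y_def subspace_diff subspace_scale)
  have xy: "x \<bullet> y = 0" using xx by (simp add: y_def c_def inner_diff_right)
  have Ax: "A *v x = y + c *\<^sub>R x" by (simp add: y_def)
  have "y \<bullet> y = 0"
  proof (rule ccontr)
    let ?a = "y \<bullet> y" and ?b = "c * (y \<bullet> y) - ?f y"
    assume "?a \<noteq> 0"
    then have a: "?a > 0" by (simp add: order_less_le)
    have yAx: "y \<bullet> (A *v x) = ?a" unfolding Ax using xy by (simp add: inner_add_right inner_commute)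
    then have xAy: "x \<bullet> (A *v y) = ?a" using sym'[of x y] by (simp add: inner_commute)
    have quad: "2 * t * ?a \<le> t\<^sup>2 * ?b" for t
    proof -
      have "x + t *\<^sub>R y \<in> W" using x y W by (simp add: subspace_add subspace_scale)
      note le[OF this]
      also have "(x + t *\<^sub>R y) \<bullet> (x + t *\<^sub>R y) = 1 + t\<^sup>2 * ?a"
        using xx xy by (simp add: inner_add_left inner_add_right inner_commute[of y x] power2_eq_square)
      also have "?f (x + t *\<^sub>R y) = c + 2 * t * ?a + t\<^sup>2 * ?f y"
        by (simp add: matrix_vector_right_distrib matrix_vector_mult_scaleR inner_add_left inner_add_right
            xAy yAx power2_eq_square c_def algebra_simps)
      finally show ?thesis by (simp add: algebra_simps)
    qed
    \<comment> \<open>t = 1 shows that \<open>?b\<close> is positive; t = \<open>?a / ?b\<close>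
      then minimizes t^2 \<open>?b\<close> - 2 t \<open>?a\<close>, whose minimum is negative,
      against \<open>quad\<close>.\<close>
    have "2 * ?a \<le> ?b" using quad[of 1] by simp
    then have b: "?b > 0" using a by linarith
    have "2 * (?a / ?b) * ?a \<le> (?a / ?b)\<^sup>2 * ?b" by (rule quad)
    then have "2 * (?a * ?a / ?b) \<le> ?a * ?a / ?b" using b by (simp add: power2_eq_square)
    moreover have "?a * ?a / ?b > 0" using a b by simp
    ultimately show False by linarith
  qed
  then have "A *v x = c *\<^sub>R x" by (simp add: Ax)
  moreover have "x \<noteq> 0" using xx by auto
  ultimately show ?thesis using that[of x] x by (auto simp: eigenvector_of_def)
qed

lemma symmetric_orthogonal_eigenvectors:
  fixes A :: "real^'n^'n"
  assumes sym: "transpose A = A"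
  shows "subspace W \<Longrightarrow> (\<And>w. w \<in> W \<Longrightarrow> A *v w \<in> W) \<Longrightarrow>
    \<exists>S \<subseteq> W. finite S \<and> pairwise orthogonal S \<and> (\<forall>w\<in>S. eigenvector_of A w) \<and> card S = dim W"
proof (induction "dim W" arbitrary: W)
  case 0
  show ?case by (rule exI[of _ "{}"]) (simp add: 0(1)[symmetric])
next
  case (Suc n)
  have "W \<noteq> {0}" using Suc.hyps(2) by auto
  then obtain w where w: "w \<in> W" "eigenvector_of A w"
    using symmetric_eigenvector_in_subspace[OF sym] Suc.prems by metis
  obtain c where c: "A *v w = c *\<^sub>R w" and w0: "w \<noteq> 0" using w(2) by (auto simp: eigenvector_of_def)
  \<comment> \<open>Stated with the span so that \<open>dim_subspace_orthogonal_to_vectors\<close>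
    applies; \<open>W_eq\<close> gives the form used otherwise.\<close>
  let ?W = "{y \<in> W. \<forall>x \<in> span {w}. orthogonal x y}"
  have W_eq: "?W = {y \<in> W. orthogonal w y}"
    by (auto simp: span_singleton orthogonal_def span_base)
  have "dim ?W + dim (span {w}) = dim W"
    by (rule dim_subspace_orthogonal_to_vectors)
       (use Suc.prems(1) w(1) span_minimal[of "{w}" W] in auto)
  moreover have "dim (span {w}) = 1" using w0 by (simp add: dim_span dim_singleton)
  ultimately have "dim ?W = n" using Suc.hyps(2) by simp
  moreover have "subspace ?W"
    unfolding W_eq using Suc.prems(1)
    by (auto simp: subspace_def orthogonal_def inner_add_right)
  moreover have "A *v y \<in> ?W" if "y \<in> ?W" for y
  proof -
    have "w \<bullet> (A *v y) = (A *v w) \<bullet> y"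
      using inner_transpose(1)[of w A y] sym by simp
    then show ?thesis using that Suc.prems(2) unfolding W_eq c by (simp add: orthogonal_def)
  qed
  ultimately obtain S where S: "S \<subseteq> ?W" "finite S" "pairwise orthogonal S"
      "\<forall>w\<in>S. eigenvector_of A w" "card S = n"
    using Suc.hyps(1)[of ?W] by auto
  have "w \<notin> S" using S(1) w0 unfolding W_eq by (auto simp: orthogonal_def)
  moreover have "pairwise orthogonal (insert w S)"
    using S(1,3) unfolding W_eq by (auto simp: pairwise_insert orthogonal_commute)
  moreover have "insert w S \<subseteq> W" using S(1) w(1) by auto
  ultimately show ?case
    using S w(2) Suc.hyps(2) by (intro exI[of _ "insert w S"]) auto
qed

section \<open>The conditions in the adjoint space\<close>

text \<open>The centralizer of v.t with the direction of v itself removed. For e8 it is the copy of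
  su(2) that mixes the first two doublets.\<close>

definition f_centralizer :: "real^8 \<Rightarrow> (real^8) set" where
  "f_centralizer v = {w. orthogonal w v \<and> f_orthogonal v w}"

lemma subspace_f_centralizer: "subspace (f_centralizer v)"
  by (auto simp: subspace_def f_centralizer_def orthogonal_def f_orthogonal_commute inner_add_left
     su3_mat_add su3_mat_scaleR matrix_mult_scaleR matrix_add_ldistrib matrix_add_rdistrib)

text \<open>Admissible families are independent subsets of the centralizer, which bounds their size
  by 3. Three of them span it, which makes it invariant; conversely a symmetric matrix has an
  orthogonal eigenbasis on an invariant subspace.\<close>

lemma eigenvectors_iff_invariant:
  assumes sym: "transpose A = A" and dim: "dim (f_centralizer v) = 3"
  shows "(\<exists>S. f_orthogonal_eigenvectors A v S \<and> card S = 3)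
       \<and> (\<forall>S. f_orthogonal_eigenvectors A v S \<longrightarrow> finite S \<and> card S \<le> 3)
     \<longleftrightarrow> (\<forall>w \<in> f_centralizer v. A *v w \<in> f_centralizer v)" (is "?L \<longleftrightarrow> ?R")
proof -
  have S: "S \<subseteq> f_centralizer v" "independent S" if "f_orthogonal_eigenvectors A v S" for S
    using that pairwise_orthogonal_independent[of S]
    by (auto simp: f_orthogonal_eigenvectors_def f_centralizer_def eigenvector_of_def)
  show ?thesis
  proof
    assume ?L
    then obtain T where T: "f_orthogonal_eigenvectors A v T" "card T = 3" by blast
    then have "f_centralizer v \<subseteq> span T"
      using card_eq_dim[OF S(1)[OF T(1)]] dim S(2)[OF T(1)] finiteI_independent[OF S(2)[OF T(1)]] by simp
    moreover have "A *v w \<in> span T" if "w \<in> span T" for w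
      using that
    proof (induction rule: span_induct_alt)
      case (step c x y)
      have "A *v x \<in> span T"
        using T(1) step(1) by (auto simp: f_orthogonal_eigenvectors_def eigenvector_of_def span_base span_scale)
      then show ?case using step
        by (simp add: matrix_vector_right_distrib matrix_vector_mult_scaleR span_add span_scale)
    qed (simp add: span_zero)
    moreover have "span T \<subseteq> f_centralizer v"
      using S(1)[OF T(1)] subspace_f_centralizer by (simp add: span_minimal)
    ultimately show ?R by blast
  next
    assume ?R
    then obtain T where "T \<subseteq> f_centralizer v" "finite T" "pairwise orthogonal T"
       "\<forall>w\<in>T. eigenvector_of A w" "card T = 3"
      using symmetric_orthogonal_eigenvectors[OF sym subspace_f_centralizer] dim by metis
    then have "f_orthogonal_eigenvectors A v T \<and> card T = 3"
      by (auto simp: f_orthogonal_eigenvectors_def f_centralizer_def)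
    then show ?L using S dim independent_card_le_dim finiteI_independent by metis
  qed
qed

text \<open>The matrix of e8 is proportional to diag(1, 1, -2), so commuting with it means having no
  entries that link the third doublet to the others.\<close>

lemma f_orthogonal_axis_8:
  "f_orthogonal (axis 8 1) w \<longleftrightarrow> w $ 4 = 0 \<and> w $ 5 = 0 \<and> w $ 6 = 0 \<and> w $ 7 = 0"
  unfolding f_orthogonal_commute
  by (auto simp add: vec_eq_iff forall_3 matrix_matrix_mult_def sum_3 su3_mat_entries axis_def
      complex_eq_iff field_simps)

lemma f_centralizer_axis_8:
  "w \<in> f_centralizer (axis 8 1) \<longleftrightarrow> w $ 4 = 0 \<and> w $ 5 = 0 \<and> w $ 6 = 0 \<and> w $ 7 = 0 \<and> w $ 8 = 0"
  by (auto simp: f_centralizer_def f_orthogonal_axis_8 orthogonal_def inner_axis)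

lemma dim_f_centralizer_axis_8: "dim (f_centralizer (axis 8 1)) = 3"
proof -
  let ?B = "{axis 1 1, axis 2 1, axis 3 1} :: (real^8) set"
  have "?B \<subseteq> f_centralizer (axis 8 1)"
    by (simp add: f_centralizer_axis_8) (simp add: axis_def)
  moreover have "f_centralizer (axis 8 1) \<subseteq> span ?B"
  proof
    fix w assume "w \<in> f_centralizer (axis 8 1)"
    then have "w $ 4 = 0 \<and> w $ 5 = 0 \<and> w $ 6 = 0 \<and> w $ 7 = 0 \<and> w $ 8 = 0"
      by (simp only: f_centralizer_axis_8)
    then have "w = w $ 1 *\<^sub>R axis 1 1 + w $ 2 *\<^sub>R axis 2 1 + w $ 3 *\<^sub>R axis 3 1"
      by (simp add: vec_eq_iff forall_8 axis_def)
    moreover have "\<dots> \<in> span ?B" by (intro span_add span_scale span_base) auto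
    ultimately show "w \<in> span ?B" by simp
  qed
  moreover have "independent ?B"
    by (rule independent_mono[OF independent_Basis]) (auto simp: axis_in_Basis_iff)
  moreover have "card ?B = 3" by (simp add: axis_eq_axis)
  ultimately show ?thesis by (metis basis_card_eq_dim)
qed

text \<open>The conditions of the theorem with the eigenvector families traded for an invariant
  subspace, which is easy to transport between frames. The clause "if non-zero" is absorbed because
  \<open>parallel_to\<close> admits the factor 0.\<close>

definition adjoint_condition :: "real^8 \<Rightarrow> real^8 \<Rightarrow> real^8^8 \<Rightarrow> real^8 \<Rightarrow> bool" where
  "adjoint_condition M L A v \<longleftrightarrow> v \<noteq> 0 \<and> parallel_to (A *v v) v \<and> self_aligned v
     \<and> (\<forall>w \<in> f_centralizer v. A *v w \<in> f_centralizer v)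
     \<and> parallel_to M v \<and> parallel_to L v \<and> parallel_to (d_contract A) v \<and> parallel_to (d_contract (A ** A)) v"

section \<open>Covariance of the conditions under basis changes\<close>

lemma d_automorphism_inverse:
  assumes "d_automorphism Q"
  shows "transpose Q *v (Q *v v) = v" "Q *v (transpose Q *v v) = v"
  by (simp_all only: matrix_vector_mul_assoc d_automorphism_orthogonal[OF assms] matrix_vector_mul_lid)

lemma parallel_to_rotate:
  assumes "d_automorphism Q"
  shows "parallel_to (Q *v w) (Q *v v) \<longleftrightarrow> parallel_to w v"
  unfolding parallel_to_def
  by (metis d_automorphism_inverse(1)[OF assms] matrix_vector_mult_scaleR)

lemma f_centralizer_rotate:
  assumes U: "unitary_matrix U" and d: "d_automorphism Q"
    and Q: "\<And>v. su3_mat (Q *v v) = dagger U ** su3_mat v ** U"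
  shows "Q *v w \<in> f_centralizer (Q *v v) \<longleftrightarrow> w \<in> f_centralizer v"
  using d by (simp add: f_centralizer_def f_orthogonal_conjugate[OF U Q] orthogonal_def d_automorphism_def)

lemma f_centralizer_rotate_image:
  assumes U: "unitary_matrix U" and d: "d_automorphism Q"
    and Q: "\<And>v. su3_mat (Q *v v) = dagger U ** su3_mat v ** U"
  shows "f_centralizer (Q *v v) = (*v) Q ` f_centralizer v"
proof (rule set_eqI)
  fix w
  have "w = Q *v (transpose Q *v w)" by (simp only: d_automorphism_inverse[OF d])
  then show "w \<in> f_centralizer (Q *v v) \<longleftrightarrow> w \<in> (*v) Q ` f_centralizer v"
    using f_centralizer_rotate[OF assms] by (metis imageE imageI)
qed

lemma dim_f_centralizer_rotate:
  assumes U: "unitary_matrix U" and d: "d_automorphism Q"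
    and Q: "\<And>v. su3_mat (Q *v v) = dagger U ** su3_mat v ** U"
  shows "dim (f_centralizer (Q *v v)) = dim (f_centralizer v)"
  unfolding f_centralizer_rotate_image[OF assms]
  by (rule dim_image_eq)
     (auto intro!: inj_on_inverseI[of _ "(*v) (transpose Q)"] simp: d_automorphism_inverse[OF d] simp del: transpose_matrix_vector)

text \<open>Justifies computing in the frame where v lies along e8. The automorphism must come from
  a unitary U, since f-orthogonality is transported by the multiplicativity of conjugation.\<close>

lemma adjoint_condition_rotate:
  assumes U: "unitary_matrix U" and d: "d_automorphism Q"
    and Q: "\<And>v. su3_mat (Q *v v) = dagger U ** su3_mat v ** U"
  shows "adjoint_condition (Q *v M) (Q *v L) (Q ** A ** transpose Q) (Q *v v) \<longleftrightarrow> adjoint_condition M L A v"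
proof -
  have mult: "(Q ** A ** transpose Q) *v (Q *v w) = Q *v (A *v w)" for w
    by (simp only: matrix_vector_mul_assoc[symmetric] d_automorphism_inverse[OF d])
  have sq: "(Q ** A ** transpose Q) ** (Q ** A ** transpose Q) = Q ** (A ** A) ** transpose Q"
  proof -
    have "(Q ** A ** transpose Q) ** (Q ** A ** transpose Q) = Q ** A ** (transpose Q ** Q) ** A ** transpose Q"
      by (simp only: matrix_mul_assoc)
    then show ?thesis by (simp only: d_automorphism_orthogonal[OF d] matrix_mul_rid matrix_mul_assoc)
  qed
  have "Q *v v = 0 \<longleftrightarrow> v = 0"
    by (metis d_automorphism_inverse(1)[OF d] matrix_vector_mult_0_right)
  moreover have "self_aligned (Q *v v) \<longleftrightarrow> self_aligned v"
    using d by (simp add: self_aligned_d_prod d_automorphism_def parallel_to_rotate)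
  moreover have "(\<forall>w \<in> f_centralizer (Q *v v). (Q ** A ** transpose Q) *v w \<in> f_centralizer (Q *v v))
     \<longleftrightarrow> (\<forall>w \<in> f_centralizer v. A *v w \<in> f_centralizer v)"
    unfolding f_centralizer_rotate_image[OF assms, of v] ball_simps mult
    by (simp only: f_centralizer_rotate_image[OF assms, symmetric] f_centralizer_rotate[OF assms])
  ultimately show ?thesis
    unfolding adjoint_condition_def mult sq d_contract_conjugate[OF d] parallel_to_rotate[OF d] by simp
qed

lemma parallel_to_scaleR: "c \<noteq> 0 \<Longrightarrow> parallel_to w (c *\<^sub>R v) \<longleftrightarrow> parallel_to w v"
  unfolding parallel_to_def
  by (metis scaleR_scaleR nonzero_eq_divide_eq)

lemma f_centralizer_scaleR: "c \<noteq> 0 \<Longrightarrow> f_centralizer (c *\<^sub>R v) = f_centralizer v"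
  by (simp add: f_centralizer_def f_orthogonal_commute su3_mat_scaleR matrix_mult_scaleR orthogonal_def)

lemma d_prod_scaleR: "d_prod (c *\<^sub>R v) (c *\<^sub>R v) = (c * c) *\<^sub>R d_prod v v"
  by (simp add: d_prod_def vec_eq_iff sum_distrib_left ac_simps)

lemma parallel_to_scaleR_left: "c \<noteq> 0 \<Longrightarrow> parallel_to (c *\<^sub>R w) v \<longleftrightarrow> parallel_to w v"
  unfolding parallel_to_def
  by (metis (no_types, opaque_lifting) scaleR_scaleR left_inverse scaleR_one)

lemma adjoint_condition_scaleR:
  "c \<noteq> 0 \<Longrightarrow> adjoint_condition M L A (c *\<^sub>R v) \<longleftrightarrow> adjoint_condition M L A v"
  by (simp add: adjoint_condition_def self_aligned_d_prod d_prod_scaleR matrix_vector_mult_scaleR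
      parallel_to_scaleR parallel_to_scaleR_left f_centralizer_scaleR)

section \<open>Diagonalization of self-aligned vectors\<close>

lemma unitary_matrix_mult: "unitary_matrix U \<Longrightarrow> unitary_matrix W \<Longrightarrow> unitary_matrix (U ** W)"
  unfolding unitary_matrix_iff dagger_mult
  by (metis matrix_mul_assoc matrix_mul_lid)

lemma unitary_matrix_cnj: "unitary_matrix U \<Longrightarrow> unitary_matrix (cnj_matrix U)"
  by (metis (no_types) unitary_matrix_def cnj_matrix_mult cnj_matrix_cnj_matrix cnj_matrix_mat_1
      transpose_transpose matrix_transpose_mul transpose_mat)

lemma unitary_matrix_dagger: "unitary_matrix U \<Longrightarrow> unitary_matrix (dagger U)"
  by (simp add: unitary_matrix_iff)

lemma unitary_matrix_transpose: "unitary_matrix U \<Longrightarrow> unitary_matrix (transpose U)"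
proof -
  have "transpose U = dagger (cnj_matrix U)" by (simp add: dagger_def)
  then show "unitary_matrix U \<Longrightarrow> unitary_matrix (transpose U)"
    by (simp add: unitary_matrix_cnj unitary_matrix_dagger)
qed

text \<open>The Householder reflection exchanging \<open>u\<close> and \<open>- e\<^sub>3\<close>.\<close>

lemma unitary_with_last_column:
  fixes u :: "complex^3"
  assumes norm: "(\<Sum>a\<in>UNIV. u $ a * cnj (u $ a)) = 1" and u3: "u $ 3 = of_real r" "r \<ge> 0"
  obtains U where "unitary_matrix U" "\<And>a. U $ a $ 3 = - u $ a"
proof
  define w where "w = u + axis 3 1"
  define s where "s = complex_of_real (1 + r)"
  define U where "U = (\<chi> a b. (if a = b then 1 else 0) - w $ a * cnj (w $ b) / s)"
  have s0: "s \<noteq> 0"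
    using u3(2) unfolding s_def of_real_eq_0_iff by linarith
  have w3: "w $ 3 = s" by (simp add: w_def s_def u3)
  have s_real: "cnj s = s" unfolding s_def by simp
  have "(\<Sum>c\<in>UNIV. cnj (w $ c) * w $ c) = (\<Sum>a\<in>UNIV. u $ a * cnj (u $ a)) + u $ 3 + cnj (u $ 3) + 1"
    by (simp add: sum_3 w_def axis_def algebra_simps)
  then have ww: "(\<Sum>c\<in>UNIV. cnj (w $ c) * w $ c) = 2 * s"
    by (simp add: norm u3 s_def)
  have "dagger U = U"
    by (simp add: vec_eq_iff dagger_entry U_def s_real mult.commute)
  moreover have "U ** U = mat 1"
  proof -
    have "(U ** U) $ a $ b = (if a = b then 1 else 0)" for a b
    proof -
      have "(U ** U) $ a $ b = (\<Sum>c\<in>UNIV. (if a = c then if c = b then 1 else 0 else 0)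
          - (if a = c then w $ c * cnj (w $ b) / s else 0)
          - (if c = b then w $ a * cnj (w $ c) / s else 0)
          + w $ a * cnj (w $ b) / s\<^sup>2 * (cnj (w $ c) * w $ c))"
        unfolding matrix_matrix_mult_def U_def
        by (auto intro!: sum.cong simp: algebra_simps power2_eq_square)
      also have "\<dots> = (if a = b then 1 else 0) - 2 * (w $ a * cnj (w $ b) / s)
          + w $ a * cnj (w $ b) / s\<^sup>2 * (\<Sum>c\<in>UNIV. cnj (w $ c) * w $ c)"
        by (simp add: sum.distrib sum_subtractf sum_distrib_left[symmetric] sum_divide_distrib[symmetric])
      also have "\<dots> = (if a = b then 1 else 0)"
        unfolding ww using s0 by (simp add: power2_eq_square)
      finally show ?thesis .
    qed
    then show ?thesis by (simp add: vec_eq_iff mat_def)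
  qed
  ultimately show "unitary_matrix U" by (simp add: unitary_matrix_iff)
  show "U $ a $ 3 = - u $ a" for a
    using s0 by (simp add: U_def w3 s_real) (simp add: w_def axis_def s_def u3)
qed

text \<open>Besides the length, the phase is normalized: a real nonnegative third entry r keeps the
  denominator 1 + r of the Householder reflection away from zero.\<close>

lemma normalized_fixed_vector:
  fixes A :: "complex^3^3"
  assumes p: "A *v p = p" "p \<noteq> 0"
  obtains u r where "A *v u = u" "(\<Sum>a\<in>UNIV. u $ a * cnj (u $ a)) = 1" "u $ 3 = of_real r" "r \<ge> 0"
proof
  define n where "n = sqrt (\<Sum>a\<in>UNIV. (cmod (p $ a))\<^sup>2)"
  define k where "k = (if p $ 3 = 0 then 1 else cnj (p $ 3) / of_real (cmod (p $ 3))) / of_real n"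
  obtain a where "p $ a \<noteq> 0" using p(2) by (auto simp: vec_eq_iff)
  then have "(\<Sum>a\<in>UNIV. (cmod (p $ a))\<^sup>2) > 0"
    by (intro sum_pos2[of UNIV a]) auto
  then have n: "n > 0" "n\<^sup>2 = (\<Sum>a\<in>UNIV. (cmod (p $ a))\<^sup>2)" by (simp_all add: n_def)
  have "cmod k = 1 / n" using n(1) by (simp add: k_def norm_divide norm_mult)
  then have kk: "k * cnj k = of_real (1 / n\<^sup>2)"
    by (simp add: complex_norm_square[symmetric] power_divide)
  show "A *v (k *s p) = k *s p" by (simp add: vector_scalar_commute p(1))
  have "(\<Sum>a\<in>UNIV. (k *s p) $ a * cnj ((k *s p) $ a)) = (\<Sum>a\<in>UNIV. (k * cnj k) * (p $ a * cnj (p $ a)))"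
    by (simp add: algebra_simps)
  also have "\<dots> = (k * cnj k) * of_real (n\<^sup>2)"
    by (simp add: n(2) sum_distrib_left complex_norm_square[symmetric])
  also have "\<dots> = 1" unfolding kk using n(1) by (simp add: power2_eq_square)
  finally show "(\<Sum>a\<in>UNIV. (k *s p) $ a * cnj ((k *s p) $ a)) = 1" .
  have "cnj (p $ 3) * p $ 3 = of_real (cmod (p $ 3)) * of_real (cmod (p $ 3))"
    using complex_norm_square[of "p $ 3"] by (simp add: power2_eq_square mult.commute)
  then show "(k *s p) $ 3 = of_real (cmod (p $ 3) / n)"
    by (simp add: k_def)
  show "cmod (p $ 3) / n \<ge> 0" using n(1) by simp
qed

lemma matrix_vector_mult_axis: "A *v axis k 1 = column k A" for A :: "complex^'n^'m"
  by (simp add: matrix_vector_mult_def axis_def column_def vec_eq_iff if_distrib cong: if_cong)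

text \<open>diag(-1, -1, 1), the value of \<open>X ** cnj_matrix X\<close> for a CP4 in normal form
  and at the same time an affine function of \<open>su3_gen 8\<close>.\<close>

definition reflection_3 :: "complex^3^3" where
  "reflection_3 = (\<chi> a b. if a = b then (if a = 3 then 1 else - 1) else 0)"

text \<open>The eigenvalues are 1 and -1, and determinant 1 makes the multiplicity of -1 even; as it
  is not 0, it is 2. The proof splits off one fixed vector and shows that the remaining 2x2 block is
  scalar.\<close>

lemma involution_diagonal:
  fixes A :: "complex^3^3"
  assumes herm: "dagger A = A" and inv: "A ** A = mat 1" and det: "det A = 1" and A1: "A \<noteq> mat 1"
  obtains U where "unitary_matrix U" "dagger U ** A ** U = reflection_3"
proof -
  \<comment> \<open>In dimension 3 the matrix -1 has determinant -1. A nonzero column of A + 1 is a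
    fixed vector of A, because A (A + 1) = A + 1.\<close>
  have "A + mat 1 \<noteq> 0"
  proof
    assume "A + mat 1 = 0"
    then have "A = - mat 1" by (simp add: add_eq_0_iff2)
    then have "det A = - 1" by (simp add: det_3 mat_def)
    with det show False by simp
  qed
  then have "\<exists>j. column j (A + mat 1) \<noteq> 0"
    by (auto simp: vec_eq_iff column_def)
  then obtain j where p0: "(A + mat 1) *v axis j 1 \<noteq> 0"
    using matrix_vector_mult_axis[of "A + mat 1"] by metis
  have "A ** (A + mat 1) = A + mat 1" by (simp add: matrix_add_ldistrib inv)
  then have fixed: "A *v ((A + mat 1) *v axis j 1) = (A + mat 1) *v axis j 1"
    by (simp only: matrix_vector_mul_assoc)
  obtain u r where u: "A *v u = u" "(\<Sum>a\<in>UNIV. u $ a * cnj (u $ a)) = 1" "u $ 3 = of_real r" "r \<ge> 0"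
    by (rule normalized_fixed_vector[OF fixed p0])
  obtain U where U: "unitary_matrix U" "\<And>a. U $ a $ 3 = - u $ a"
    using unitary_with_last_column[OF u(2-4)] by blast
  define B where "B = dagger U ** A ** U"
  have UU: "dagger U ** U = mat 1" "U ** dagger U = mat 1" using U(1) by (simp_all add: unitary_matrix_iff)
  have "dagger B = B" by (simp add: B_def dagger_mult herm matrix_mul_assoc)
  then have B_sym: "B $ a $ b = cnj (B $ b $ a)" for a b by (metis dagger_entry)
  have BB: "B ** B = mat 1"
    unfolding B_def unitary_conjugate_mult[OF U(1), symmetric] inv by (rule unitary_conjugate_mat[OF U(1)])
  have "det B = det A * (det (dagger U) * det U)" by (simp add: B_def det_mul)
  also have "det (dagger U) * det U = 1" by (simp only: det_mul[symmetric] UU det_I)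
  finally have detB: "det B = 1" by (simp add: det)
  have "A ** U = U ** B" by (simp add: B_def matrix_mul_assoc UU)
  have Ue: "U *v axis 3 1 = - u" by (simp add: matrix_vector_mult_axis column_def vec_eq_iff U(2))
  have Au: "A *v (- u) = - u" using u(1) by (simp add: matrix_vector_mult_def vec_eq_iff sum_negf)
  have "B *v axis 3 1 = dagger U *v (A *v (U *v axis 3 1))"
    by (simp only: B_def matrix_vector_mul_assoc matrix_mul_assoc)
  also have "\<dots> = dagger U *v (U *v axis 3 1)" by (simp only: Ue Au)
  also have "\<dots> = axis 3 1" by (simp only: matrix_vector_mul_assoc UU matrix_vector_mul_lid)
  finally have "column 3 B = axis 3 1" by (simp only: matrix_vector_mult_axis)
  then have "B $ a $ 3 = (if a = 3 then 1 else 0)" for a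
    by (simp add: column_def axis_def vec_eq_iff)
  then have B3: "B $ 1 $ 3 = 0" "B $ 2 $ 3 = 0" "B $ 3 $ 3 = 1" by simp_all
  then have B3': "B $ 3 $ 1 = 0" "B $ 3 $ 2 = 0" using B_sym[of 3 1] B_sym[of 3 2] by simp_all
  have BB': "(B ** B) $ a $ b = (if a = b then 1 else 0)" for a b by (simp add: BB mat_def)
  let ?t = "B $ 1 $ 1 + B $ 2 $ 2"
  have e: "B $ 1 $ 1 * B $ 1 $ 1 + B $ 1 $ 2 * B $ 2 $ 1 = 1"
    "B $ 2 $ 1 * B $ 1 $ 2 + B $ 2 $ 2 * B $ 2 $ 2 = 1"
    "B $ 1 $ 1 * B $ 1 $ 2 + B $ 1 $ 2 * B $ 2 $ 2 = 0"
    "B $ 2 $ 1 * B $ 1 $ 1 + B $ 2 $ 2 * B $ 2 $ 1 = 0"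
    using BB'[of 1 1] BB'[of 2 2] BB'[of 1 2] BB'[of 2 1]
    by (simp_all add: matrix_matrix_mult_def sum_3 B3 B3')
  have d: "B $ 1 $ 1 * B $ 2 $ 2 - B $ 1 $ 2 * B $ 2 $ 1 = 1"
    using detB by (simp add: det_3 B3 B3')
  \<comment> \<open>Cayley-Hamilton for the upper 2x2 block: its square and its determinant are both
    1, so trace times block equals 2.\<close>
  have t: "B $ 1 $ 1 * ?t = 2" "B $ 2 $ 2 * ?t = 2" "B $ 1 $ 2 * ?t = 0" "B $ 2 $ 1 * ?t = 0"
    using e d by algebra+
  then have t0: "?t \<noteq> 0" by auto
  then have B12: "B $ 1 $ 2 = 0" "B $ 2 $ 1 = 0" using t by simp_all
  have B22: "B $ 2 $ 2 = B $ 1 $ 1" using t(1,2) t0 by (metis mult_right_cancel)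
  have "B $ 1 $ 1 = 1 \<or> B $ 1 $ 1 = - 1" using e(1) B12 by (simp add: square_eq_1_iff)
  moreover have "B $ 1 $ 1 \<noteq> 1"
  proof
    assume "B $ 1 $ 1 = 1"
    then have "B = mat 1" by (simp add: vec_eq_iff forall_3 mat_def B3 B3' B12 B22)
    then have "A ** U = U" using \<open>A ** U = U ** B\<close> by simp
    then have "A = mat 1" using UU(2) by (metis matrix_mul_assoc matrix_mul_rid)
    with A1 show False by simp
  qed
  ultimately have "B = reflection_3"
    by (simp add: vec_eq_iff forall_3 reflection_3_def B3 B3' B12 B22)
  with U(1) show ?thesis using that by (simp add: B_def)
qed

lemma scaleR_mat_of_real: "c *\<^sub>R (mat d :: complex^3^3) = mat (of_real c * d)"
  by (simp add: vec_eq_iff mat_def scaleR_conv_of_real[where 'a = complex])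

text \<open>Self-alignment makes T = v.t satisfy 2 T^2 = n/3 + c T. Completing the square gives (2 T
  - c/2)^2 = c^2/4 + 2n/3, a positive number, by whose root s one divides.\<close>

lemma self_aligned_involution:
  assumes v: "v \<noteq> 0" "self_aligned v"
  obtains a b where "a \<noteq> 0"
    "(a *\<^sub>R su3_mat v + mat (of_real b)) ** (a *\<^sub>R su3_mat v + mat (of_real b)) = mat 1"
proof -
  obtain c where c: "d_prod v v = c *\<^sub>R v"
    using v(2) by (auto simp: self_aligned_d_prod parallel_to_def)
  define n where "n = v \<bullet> v"
  define s where "s = sqrt (c\<^sup>2 / 4 + 2 * n / 3)"
  have "n > 0" using v(1) by (simp add: n_def)
  then have "c\<^sup>2 / 4 + 2 * n / 3 > 0" by (simp add: add_nonneg_pos)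
  then have s: "s > 0" "s\<^sup>2 = c\<^sup>2 / 4 + 2 * n / 3" by (simp_all add: s_def)
  let ?T = "su3_mat v"
  have TT: "?T ** ?T + ?T ** ?T = mat (of_real (n / 3)) + c *\<^sub>R ?T"
    using su3_mat_anticommutator[of v v] by (simp add: c su3_mat_scaleR n_def)
  let ?B = "2 *\<^sub>R ?T + mat (of_real (- c / 2))"
  have "(?B ** ?B) $ i $ j = mat (of_real (s\<^sup>2)) $ i $ j" for i j
  proof -
    have "?B ** ?B = 4 *\<^sub>R (?T ** ?T) + 4 *\<^sub>R (mat (of_real (- c / 2)) ** ?T)
        + mat (of_real (- c / 2)) ** mat (of_real (- c / 2))"
      by (simp add: matrix_add_ldistrib matrix_add_rdistrib matrix_mult_scaleR mat_commute[of ?T])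
         (simp add: vec_eq_iff scaleR_conv_of_real[where 'a = complex] algebra_simps)
    then have "(?B ** ?B) $ i $ j = 2 * ((?T ** ?T) $ i $ j + (?T ** ?T) $ i $ j) - 2 * of_real c * ?T $ i $ j
        + of_real (c\<^sup>2 / 4) * mat 1 $ i $ j"
      by (simp add: mat_mult_entry scaleR_conv_of_real[where 'a = complex] power2_eq_square)
         (simp add: mat_def)
    also have "(?T ** ?T) $ i $ j + (?T ** ?T) $ i $ j = of_real (n / 3) * mat 1 $ i $ j + of_real c * ?T $ i $ j"
      using arg_cong[OF TT, of "\<lambda>A. A $ i $ j"]
      by (simp add: scaleR_conv_of_real[where 'a = complex]) (simp add: mat_def)
    finally show ?thesis by (simp add: s(2) mat_def algebra_simps)
  qed
  then have BB: "?B ** ?B = mat (of_real (s\<^sup>2))" by (simp add: vec_eq_iff)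
  have "(2 / s) *\<^sub>R ?T + mat (of_real (- c / 2 / s)) = (1 / s) *\<^sub>R ?B"
    by (simp add: scaleR_add_right scaleR_mat_of_real mult.commute)
  then have "((2 / s) *\<^sub>R ?T + mat (of_real (- c / 2 / s))) ** ((2 / s) *\<^sub>R ?T + mat (of_real (- c / 2 / s)))
      = (1 / s) *\<^sub>R (1 / s) *\<^sub>R (?B ** ?B)"
    by (simp only: matrix_mult_scaleR)
  also have "\<dots> = mat 1"
    unfolding BB using s(1) by (simp add: scaleR_mat_of_real power2_eq_square)
  finally show ?thesis using that[of "2 / s" "- c / 2 / s"] s(1) by simp
qed

lemma dagger_add: "dagger (A + B) = dagger A + dagger B"
  by (simp add: vec_eq_iff dagger_entry)

lemma dagger_scaleR: "dagger (c *\<^sub>R A) = c *\<^sub>R dagger A"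
  by (simp add: vec_eq_iff dagger_entry)

lemma dagger_mat_of_real: "dagger (mat (of_real c)) = mat (of_real c)"
  by (simp add: vec_eq_iff dagger_entry mat_def)

lemma self_aligned_diagonal:
  assumes v: "v \<noteq> 0" "self_aligned v"
  obtains U c where "unitary_matrix U" "c \<noteq> 0" "dagger U ** su3_mat v ** U = su3_mat (c *\<^sub>R axis 8 1)"
proof -
  obtain a b where a: "a \<noteq> 0"
    and inv: "(a *\<^sub>R su3_mat v + mat (of_real b)) ** (a *\<^sub>R su3_mat v + mat (of_real b)) = mat 1"
    by (rule self_aligned_involution[OF v])
  \<comment> \<open>The sign of the involution is still free, and changing it changes the
    determinant because the dimension is odd.\<close>
  have "\<exists>a b. a \<noteq> 0 \<and> (a *\<^sub>R su3_mat v + mat (of_real b)) ** (a *\<^sub>R su3_mat v + mat (of_real b)) = mat 1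
      \<and> det (a *\<^sub>R su3_mat v + mat (of_real b)) = 1"
  proof -
    let ?A = "a *\<^sub>R su3_mat v + mat (of_real b)"
    have neg: "(- a) *\<^sub>R su3_mat v + mat (of_real (- b)) = - ?A"
      by (simp add: vec_eq_iff mat_def)
    have negneg: "(- A) ** (- A) = A ** A" for A :: "complex^3^3"
      by (simp add: vec_eq_iff matrix_matrix_mult_def)
    have detneg: "det (- A) = - det A" for A :: "complex^3^3"
      by (simp add: det_3)
    have "det ?A * det ?A = 1" by (simp only: det_mul[symmetric] inv det_I)
    then have "det ?A = 1 \<or> det ?A = - 1" by (simp only: square_eq_1_iff)
    then show ?thesis
    proof
      assume "det ?A = 1"
      then show ?thesis using a inv by blast
    next
      assume "det ?A = - 1"
      then have "det (- ?A) = 1" by (simp only: detneg) simp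
      moreover have "(- ?A) ** (- ?A) = mat 1" by (simp only: negneg inv)
      ultimately show ?thesis unfolding neg[symmetric] using a
        by (intro exI[of _ "- a"] exI[of _ "- b"]) simp
    qed
  qed
  then obtain a b where a: "a \<noteq> 0"
    and inv: "(a *\<^sub>R su3_mat v + mat (of_real b)) ** (a *\<^sub>R su3_mat v + mat (of_real b)) = mat 1"
    and det: "det (a *\<^sub>R su3_mat v + mat (of_real b)) = 1"
    by blast
  let ?A = "a *\<^sub>R su3_mat v + mat (of_real b)"
  \<comment> \<open>T is traceless, so the identity would force b = 1 and then T = 0.\<close>
  have "?A \<noteq> mat 1"
  proof
    assume A1: "?A = mat 1"
    have "trace (a *\<^sub>R su3_mat v) = a *\<^sub>R trace (su3_mat v)" by (simp add: trace_def scaleR_sum_right)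
    then have "trace ?A = 3 * of_real b" by (simp add: trace_add trace_mat_3)
    then have "of_real b = (1 :: complex)" by (simp add: A1 trace_mat_3)
    then have "a *\<^sub>R su3_mat v = 0" using A1 by simp
    then have "su3_mat v = su3_mat 0" using a by simp
    then show False using v(1) by (simp only: su3_mat_inject)
  qed
  moreover have "dagger ?A = ?A" by (simp add: dagger_add dagger_scaleR dagger_mat_of_real)
  ultimately obtain U where U: "unitary_matrix U" "dagger U ** ?A ** U = reflection_3"
    using involution_diagonal inv det by metis
  obtain Q where Q: "d_automorphism Q" "\<And>v. su3_mat (Q *v v) = dagger U ** su3_mat v ** U"
    using unitary_automorphism[OF U(1)] by blast
  let ?w = "Q *v v"
  have "a *\<^sub>R su3_mat ?w + mat (of_real b) = reflection_3"
    using U(2) unitary_conjugate_mat[OF U(1), of "of_real b"]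
    by (simp add: Q(2) matrix_add_ldistrib matrix_add_rdistrib matrix_mult_scaleR)
  then have w: "a *\<^sub>R su3_mat ?w $ i $ j + mat (of_real b) $ i $ j = reflection_3 $ i $ j" for i j
    by (simp add: vec_eq_iff)
  have "?w $ 1 = 0 \<and> ?w $ 2 = 0 \<and> ?w $ 4 = 0 \<and> ?w $ 5 = 0 \<and> ?w $ 6 = 0 \<and> ?w $ 7 = 0"
    using w[of 1 2] w[of 1 3] w[of 2 3] a
    by (simp add: su3_mat_entries reflection_3_def mat_def complex_eq_iff)
  \<comment> \<open>Component 3 measures the difference of the first two diagonal entries, which
    agree in \<open>reflection_3\<close>.\<close>
  moreover have "?w $ 3 = 0"
  proof -
    have "a * (?w $ 3 + ?w $ 8 / sqrt 3) / 2 + b = - 1" "a * (?w $ 8 / sqrt 3 - ?w $ 3) / 2 + b = - 1"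
      using w[of 1 1] w[of 2 2]
      by (simp_all add: su3_mat_entries reflection_3_def mat_def complex_eq_iff)
    then have "a * (?w $ 3 + ?w $ 8 / sqrt 3) = a * (?w $ 8 / sqrt 3 - ?w $ 3)" by linarith
    then show ?thesis using a by simp
  qed
  ultimately have eq: "?w = ?w $ 8 *\<^sub>R axis 8 1"
    by (simp add: vec_eq_iff forall_8 axis_def)
  have "?w \<noteq> 0"
    using v(1) d_automorphism_inverse(1)[OF Q(1), of v] by (metis matrix_vector_mult_0_right)
  then have "?w $ 8 \<noteq> 0" using eq by auto
  moreover have "dagger U ** su3_mat v ** U = su3_mat (?w $ 8 *\<^sub>R axis 8 1)"
    using Q(2)[of v] eq by simp
  ultimately show ?thesis using that[OF U(1)] by blast
qed

section \<open>Normal form of CP transformations of order 4\<close>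

text \<open>A further diagonal basis change could remove both phases. They stay because the phase of
  \<open>x * cnj y\<close> is the angle that must be fitted to a given potential.\<close>

definition cp4_matrix :: "complex \<Rightarrow> complex \<Rightarrow> complex^3^3" where
  "cp4_matrix x y = vector [vector [0, x, 0], vector [- x, 0, 0], vector [0, 0, y]]"

lemma unitary_cp4_matrix:
  "unitary_matrix (cp4_matrix x y) \<longleftrightarrow> cmod x = 1 \<and> cmod y = 1"
proof -
  have "cmod z = 1 \<longleftrightarrow> z * cnj z = 1" for z
  proof -
    have "z * cnj z = 1 \<longleftrightarrow> complex_of_real ((cmod z)\<^sup>2) = of_real 1"
      by (simp only: complex_norm_square of_real_1)
    also have "\<dots> \<longleftrightarrow> cmod z = 1" using norm_ge_zero[of z]
      by (simp only: of_real_eq_iff) (auto simp: power2_eq_1_iff simp del: norm_ge_zero)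
    finally show ?thesis by simp
  qed
  then show ?thesis
    by (auto simp add: unitary_matrix_iff vec_eq_iff forall_3 matrix_matrix_mult_def sum_3 dagger_entry
      cp4_matrix_def mat_def mult.commute)
qed

lemma cp4_matrix_square:
  "cmod x = 1 \<Longrightarrow> cmod y = 1 \<Longrightarrow> cp4_matrix x y ** cnj_matrix (cp4_matrix x y) = reflection_3"
  using complex_norm_square[of x] complex_norm_square[of y]
  by (simp add: vec_eq_iff forall_3 matrix_matrix_mult_def sum_3 cnj_matrix_entry
      cp4_matrix_def reflection_3_def)

text \<open>\<open>X ** cnj_matrix X\<close> is unitary with square 1, hence Hermitian, and its
  determinant is |det X|^2 = 1. In its eigenframe unitarity turns \<open>YY\<close> into Y = R
  (transpose Y) with R = diag(-1, -1, 1): the first two rows are antisymmetric and the third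
  symmetric against the columns, which kills every entry outside the normal form.\<close>

lemma cp4_normal_form:
  fixes X :: "complex^3^3"
  assumes X: "unitary_matrix X" "cp_order_4 X"
  obtains U x y where "unitary_matrix U" "cmod x = 1" "cmod y = 1" "dagger U ** X ** cnj_matrix U = cp4_matrix x y"
proof -
  define A where "A = X ** cnj_matrix X"
  have A: "A \<noteq> mat 1" "A ** A = mat 1" using X(2) by (simp_all add: cp_order_4_def A_def)
  have uA: "unitary_matrix A" unfolding A_def by (intro unitary_matrix_mult unitary_matrix_cnj X(1))
  then have "dagger A = A"
    using A(2) by (metis unitary_matrix_iff matrix_mul_assoc matrix_mul_lid matrix_mul_rid)
  moreover have "det A = 1"
  proof -
    have "det (dagger X) = det (cnj_matrix X)" by (simp add: dagger_def det_transpose)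
    then have "det A = det (X ** dagger X)" by (simp add: A_def det_mul)
    then show ?thesis using X(1) by (simp add: unitary_matrix_iff)
  qed
  ultimately obtain U where U: "unitary_matrix U" "dagger U ** A ** U = reflection_3"
    using involution_diagonal A by metis
  define Y where "Y = dagger U ** X ** cnj_matrix U"
  have uY: "unitary_matrix Y"
    unfolding Y_def by (intro unitary_matrix_mult unitary_matrix_cnj unitary_matrix_dagger U X)
  have "cnj_matrix U ** cnj_matrix (dagger U) = mat 1"
    using U(1) by (simp add: cnj_matrix_mult[symmetric] unitary_matrix_iff)
  moreover have "Y ** cnj_matrix Y = dagger U ** X ** (cnj_matrix U ** cnj_matrix (dagger U)) ** cnj_matrix X ** U"
    by (simp add: Y_def cnj_matrix_mult matrix_mul_assoc)
  ultimately have YY: "Y ** cnj_matrix Y = reflection_3"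
    using U(2) by (simp add: A_def matrix_mul_assoc)
  have "cnj_matrix Y ** transpose Y = cnj_matrix (Y ** dagger Y)"
    by (simp add: cnj_matrix_mult dagger_def vec_eq_iff cnj_matrix_def transpose_def matrix_matrix_mult_def)
  then have "Y = Y ** (cnj_matrix Y ** transpose Y)"
    using uY by (simp add: unitary_matrix_iff)
  also have "\<dots> = (Y ** cnj_matrix Y) ** transpose Y" by (rule matrix_mul_assoc)
  also have "\<dots> = reflection_3 ** transpose Y" by (simp only: YY)
  finally have eq: "Y = reflection_3 ** transpose Y" .
  have "\<forall>a b. (reflection_3 ** transpose Y) $ a $ b = (if a = 3 then 1 else - 1) * Y $ b $ a"
    unfolding forall_3 by (simp add: matrix_matrix_mult_def sum_3 reflection_3_def transpose_entry)
  then have entry: "(reflection_3 ** transpose Y) $ a $ b = (if a = 3 then 1 else - 1) * Y $ b $ a" for a b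
    by blast
  have Y: "Y $ a $ b = (if a = 3 then 1 else - 1) * Y $ b $ a" for a b
    by (rule trans[OF _ entry], rule arg_cong[OF eq])
  have zero: "z = - z \<longleftrightarrow> z = 0" for z :: complex by auto
  have "Y $ 1 $ 1 = 0" "Y $ 2 $ 2 = 0" using Y[of 1 1] Y[of 2 2] zero by simp_all
  moreover have "Y $ 1 $ 3 = 0" "Y $ 3 $ 1 = 0" using Y[of 1 3] Y[of 3 1] zero by simp_all
  moreover have "Y $ 2 $ 3 = 0" "Y $ 3 $ 2 = 0" using Y[of 2 3] Y[of 3 2] zero by simp_all
  moreover have "Y $ 2 $ 1 = - Y $ 1 $ 2" using Y[of 2 1] by simp
  ultimately have eq: "Y = cp4_matrix (Y $ 1 $ 2) (Y $ 3 $ 3)"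
    by (simp add: vec_eq_iff forall_3 cp4_matrix_def)
  then have "cmod (Y $ 1 $ 2) = 1 \<and> cmod (Y $ 3 $ 3) = 1"
    using uY unitary_cp4_matrix by metis
  then show ?thesis using that[OF U(1)] eq unfolding Y_def by metis
qed

text \<open>The action on the components 4, ..., 7 squares to \<open>-1\<close>.\<close>

lemma cp4_adjoint_action:
  assumes Q: "\<And>v. su3_mat (Q *v v) = transpose (dagger (cp4_matrix x y) ** su3_mat v ** cp4_matrix x y)"
    and xy: "cmod x = 1" "cmod y = 1"
  defines "p \<equiv> Re (x * cnj y)" and "q \<equiv> Im (x * cnj y)"
  shows "(Q *v v) $ 1 = - v $ 1" "(Q *v v) $ 2 = - v $ 2" "(Q *v v) $ 3 = - v $ 3"
    "(Q *v v) $ 4 = - p * v $ 6 + q * v $ 7" "(Q *v v) $ 5 = q * v $ 6 + p * v $ 7"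
    "(Q *v v) $ 6 = p * v $ 4 - q * v $ 5" "(Q *v v) $ 7 = - q * v $ 4 - p * v $ 5"
    "(Q *v v) $ 8 = v $ 8"
proof -
  have n: "x * cnj x = 1" "y * cnj y = 1"
    using xy complex_norm_square[of x] complex_norm_square[of y] by simp_all
  have e: "su3_mat (Q *v v) $ a $ b = (\<Sum>c\<in>UNIV. \<Sum>d\<in>UNIV. cnj (cp4_matrix x y $ d $ b) * su3_mat v $ d $ c * cp4_matrix x y $ c $ a)" for a b
    by (simp add: Q transpose_entry matrix_matrix_mult_def dagger_entry sum_distrib_right)
  have 12: "su3_mat (Q *v v) $ 1 $ 2 = - (x * cnj x) * su3_mat v $ 1 $ 2"
    and 11: "su3_mat (Q *v v) $ 1 $ 1 = (x * cnj x) * su3_mat v $ 2 $ 2"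
    and 33: "su3_mat (Q *v v) $ 3 $ 3 = (y * cnj y) * su3_mat v $ 3 $ 3"
    and 13: "su3_mat (Q *v v) $ 1 $ 3 = - (x * cnj y) * su3_mat v $ 3 $ 2"
    and 23: "su3_mat (Q *v v) $ 2 $ 3 = (x * cnj y) * su3_mat v $ 3 $ 1"
    unfolding e by (simp_all add: sum_3 cp4_matrix_def)
  show "(Q *v v) $ 1 = - v $ 1" "(Q *v v) $ 2 = - v $ 2"
    using 12 unfolding n by (simp_all add: su3_mat_entries complex_eq_iff)
  show 8: "(Q *v v) $ 8 = v $ 8"
    using 33 unfolding n by (simp add: su3_mat_entries complex_eq_iff)
  show "(Q *v v) $ 3 = - v $ 3"
  proof -
    have "((Q *v v) $ 3 + (Q *v v) $ 8 / sqrt 3) / 2 = (- v $ 3 + v $ 8 / sqrt 3) / 2"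
      using 11 unfolding n su3_mat_entries mult_1 complex.inject by (rule conjunct1)
    moreover have "(a + t) / 2 = (b + t) / 2 \<Longrightarrow> a = b" for a b t :: real by simp
    ultimately show ?thesis unfolding 8 by blast
  qed
  show "(Q *v v) $ 4 = - p * v $ 6 + q * v $ 7" "(Q *v v) $ 5 = q * v $ 6 + p * v $ 7"
    using 13 unfolding p_def q_def by (simp_all add: su3_mat_entries complex_eq_iff field_simps)
  show "(Q *v v) $ 6 = p * v $ 4 - q * v $ 5" "(Q *v v) $ 7 = - q * v $ 4 - p * v $ 5"
    using 23 unfolding p_def q_def by (simp_all add: su3_mat_entries complex_eq_iff field_simps)
qed

section \<open>Uniqueness of the bilinear form of a potential\<close>

lemma bilin_entries:
  "bilin \<phi> $ 1 = Re (doublet_prod \<phi> 1 2)" "bilin \<phi> $ 2 = Im (doublet_prod \<phi> 1 2)"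
  "bilin \<phi> $ 3 = (Re (doublet_prod \<phi> 1 1) - Re (doublet_prod \<phi> 2 2)) / 2"
  "bilin \<phi> $ 4 = Re (doublet_prod \<phi> 1 3)" "bilin \<phi> $ 5 = Im (doublet_prod \<phi> 1 3)"
  "bilin \<phi> $ 6 = Re (doublet_prod \<phi> 2 3)" "bilin \<phi> $ 7 = Im (doublet_prod \<phi> 2 3)"
  "bilin \<phi> $ 8 = (Re (doublet_prod \<phi> 1 1) + Re (doublet_prod \<phi> 2 2) - 2 * Re (doublet_prod \<phi> 3 3)) / (2 * sqrt 3)"
proof -
  have "Re (doublet_prod \<phi> b a) = Re (doublet_prod \<phi> a b)" "Im (doublet_prod \<phi> b a) = - Im (doublet_prod \<phi> a b)" for a b
    using cnj_doublet_prod[of \<phi> a b] by (simp_all add: complex_eq_iff)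
  note c = this[of 2 1] this[of 3 1] this[of 3 2]
  show "bilin \<phi> $ 1 = Re (doublet_prod \<phi> 1 2)" "bilin \<phi> $ 2 = Im (doublet_prod \<phi> 1 2)"
  "bilin \<phi> $ 3 = (Re (doublet_prod \<phi> 1 1) - Re (doublet_prod \<phi> 2 2)) / 2"
  "bilin \<phi> $ 4 = Re (doublet_prod \<phi> 1 3)" "bilin \<phi> $ 5 = Im (doublet_prod \<phi> 1 3)"
  "bilin \<phi> $ 6 = Re (doublet_prod \<phi> 2 3)" "bilin \<phi> $ 7 = Im (doublet_prod \<phi> 2 3)"
  "bilin \<phi> $ 8 = (Re (doublet_prod \<phi> 1 1) + Re (doublet_prod \<phi> 2 2) - 2 * Re (doublet_prod \<phi> 3 3)) / (2 * sqrt 3)"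
    by (simp_all add: bilin_def sum_3 su3_gen_def gell_mann_def c add_divide_distrib diff_divide_distrib)
qed

text \<open>The arguments are the two columns of the doublet matrix, which polarization varies
  independently.\<close>

definition doublet_pair :: "complex^3 \<Rightarrow> complex^3 \<Rightarrow> doublets" where
  "doublet_pair x y = (\<chi> a s. if s = 1 then x $ a else y $ a)"

lemma doublet_prod_pair: "doublet_prod (doublet_pair x y) a b = cnj (x $ a) * x $ b + cnj (y $ a) * y $ b"
  by (simp add: doublet_prod_def doublet_pair_def sum_2)

lemma bilin_pair:
  "bilin (doublet_pair x y) = bilin (doublet_pair x 0) + bilin (doublet_pair y 0)"
  "bilin0 (doublet_pair x y) = bilin0 (doublet_pair x 0) + bilin0 (doublet_pair y 0)"
  "bilin (doublet_pair 0 0) = 0" "bilin0 (doublet_pair 0 0) = 0"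
  by (simp_all add: bilin_def bilin0_def doublet_prod_pair vec_eq_iff sum.distrib distrib_right distrib_left)

text \<open>On a single column such a functional is a Hermitian form: \<open>g1\<close>,
  \<open>g2\<close>, \<open>g3\<close> are its diagonal entries, found on unit vectors, and sums of
  unit vectors with relative factor 1 or i detect the real and imaginary parts off the
  diagonal.\<close>

lemma bilin_functional_zero:
  assumes zero: "\<And>x. c0 * bilin0 (doublet_pair x 0) + c \<bullet> bilin (doublet_pair x 0) = 0"
  shows "c0 = 0" "c = 0"
proof -
  define g1 g2 g3 where "g1 = c0 / sqrt 3 + c $ 3 / 2 + c $ 8 / (2 * sqrt 3)"
    and "g2 = c0 / sqrt 3 - c $ 3 / 2 + c $ 8 / (2 * sqrt 3)" and "g3 = c0 / sqrt 3 - c $ 8 / sqrt 3"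
  have expand: "c0 * bilin0 (doublet_pair x 0) + c \<bullet> bilin (doublet_pair x 0)
      = g1 * Re (cnj (x $ 1) * x $ 1) + g2 * Re (cnj (x $ 2) * x $ 2) + g3 * Re (cnj (x $ 3) * x $ 3)
      + c $ 1 * Re (cnj (x $ 1) * x $ 2) + c $ 2 * Im (cnj (x $ 1) * x $ 2)
      + c $ 4 * Re (cnj (x $ 1) * x $ 3) + c $ 5 * Im (cnj (x $ 1) * x $ 3)
      + c $ 6 * Re (cnj (x $ 2) * x $ 3) + c $ 7 * Im (cnj (x $ 2) * x $ 3)" for x
    unfolding inner_vec_def sum_8 bilin_entries bilin0_def doublet_prod_pair sum_3 g1_def g2_def g3_def
    by (simp add: algebra_simps add_divide_distrib diff_divide_distrib)
  note z = zero[unfolded expand]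
  have g: "g1 = 0" "g2 = 0" "g3 = 0"
    using z[of "axis 1 1"] z[of "axis 2 1"] z[of "axis 3 1"] by (simp_all add: axis_def)
  have re: "c $ 1 = 0" "c $ 4 = 0" "c $ 6 = 0"
    using z[of "axis 1 1 + axis 2 1"] z[of "axis 1 1 + axis 3 1"] z[of "axis 2 1 + axis 3 1"]
    by (simp_all add: axis_def g)
  have im: "c $ 2 = 0" "c $ 5 = 0" "c $ 7 = 0"
    using z[of "axis 1 1 + axis 2 \<i>"] z[of "axis 1 1 + axis 3 \<i>"] z[of "axis 2 1 + axis 3 \<i>"]
    by (simp_all add: axis_def g)
  have 3: "c $ 3 = 0" using g(1,2) by (simp add: g1_def g2_def)
  have 80: "c0 = c $ 8" using g(3) by (simp add: g3_def)
  have "c0 / sqrt 3 + c0 / (2 * sqrt 3) = 0" using g(1) by (simp add: g1_def 3 80)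
  then show c0: "c0 = 0" by (simp add: field_simps)
  show "c = 0" using re im 3 80 c0 by (simp add: vec_eq_iff forall_8)
qed

text \<open>The bilinears of a pair of vectors are sums of two rank-one contributions, so polarization
  leaves a bilinear form in rank-one bilinears, which span the whole space.\<close>

lemma bilinear_potential_zero:
  assumes zero: "\<And>\<phi>. bilinear_potential m M l L A \<phi> = 0" and sym: "transpose A = A"
  shows "M = 0" "L = 0" "A = 0"
proof -
  define r0 where "r0 x = bilin0 (doublet_pair x 0)" for x
  define r where "r x = bilin (doublet_pair x 0)" for x
  define F where "F s v = m * s + M \<bullet> v + l * s\<^sup>2 + s * (L \<bullet> v) + v \<bullet> (A *v v)" for s v
  have F: "F (r0 x + r0 y) (r x + r y) = 0" for x y
    using zero[of "doublet_pair x y"]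
    unfolding bilinear_potential_inner bilin_pair(1,2)[of x y] F_def r0_def r_def .
  have F1: "F (r0 x) (r x) = 0" for x
    using zero[of "doublet_pair x 0"] unfolding bilinear_potential_inner F_def r0_def r_def .
  have sym': "v \<bullet> (A *v w) = w \<bullet> (A *v v)" for v w
    using inner_transpose(1)[of v A w] sym by (simp add: inner_commute)
  have pol: "(2 * l * r0 x + L \<bullet> r x) * r0 y + (r0 x *\<^sub>R L + 2 *\<^sub>R (A *v r x)) \<bullet> r y = 0" for x y
  proof -
    have "F (r0 x + r0 y) (r x + r y) - F (r0 x) (r x) - F (r0 y) (r y)
      = 2 * l * r0 x * r0 y + r0 x * (L \<bullet> r y) + r0 y * (L \<bullet> r x) + r x \<bullet> (A *v r y) + r y \<bullet> (A *v r x)"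
      by (simp add: F_def inner_add_left inner_add_right matrix_vector_right_distrib power2_eq_square algebra_simps)
    then show ?thesis
      by (simp add: F F1 sym'[of "r x" "r y"] inner_add_left inner_commute[of "r y"] algebra_simps)
  qed
  have row: "2 * l * r0 x + L \<bullet> r x = 0" "r0 x *\<^sub>R L + 2 *\<^sub>R (A *v r x) = 0" for x
    using bilin_functional_zero[of "2 * l * r0 x + L \<bullet> r x" "r0 x *\<^sub>R L + 2 *\<^sub>R (A *v r x)"] pol[of x]
    unfolding r0_def r_def by blast+
  show L: "L = 0"
    using bilin_functional_zero(2)[of "2 * l" L] row(1) unfolding r0_def r_def by blast
  have l: "l = 0"
    using bilin_functional_zero(1)[of "2 * l" L] row(1) unfolding r0_def r_def by simp
  have "(A *v r x) $ i = 0" for x i using row(2)[of x] L by simp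
  then have "0 * r0 x + (A $ i) \<bullet> r x = 0" for x i by (simp add: matrix_mult_dot)
  then have "A $ i = 0" for i
    using bilin_functional_zero(2)[of 0 "A $ i"] unfolding r0_def r_def by blast
  then show A: "A = 0" by (simp add: vec_eq_iff)
  have "m * r0 x + M \<bullet> r x = 0" for x using F1[of x] by (simp add: F_def L A l)
  then show "M = 0"
    using bilin_functional_zero(2)[of m M] unfolding r0_def r_def by blast
qed

text \<open>Turns invariance of the potential as a function into invariance of its
  coefficients.\<close>

lemma bilinear_potential_unique:
  assumes eq: "\<And>\<phi>. bilinear_potential m M l L A \<phi> = bilinear_potential m' M' l' L' A' \<phi>"
    and sym: "transpose A = A" "transpose A' = A'"
  shows "M = M'" "L = L'" "A = A'"
proof -
  have "bilinear_potential (m - m') (M - M') (l - l') (L - L') (A - A') \<phi> = 0" for \<phi>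
    using eq[of \<phi>]
    by (simp add: bilinear_potential_inner inner_diff_left inner_diff_right matrix_vector_mult_diff_rdistrib
        left_diff_distrib right_diff_distrib)
  moreover have "transpose (A - A') = A - A'"
    using sym by (simp add: vec_eq_iff transpose_def)
  ultimately have "M - M' = 0" "L - L' = 0" "A - A' = 0"
    using bilinear_potential_zero by blast+
  then show "M = M'" "L = L'" "A = A'" by simp_all
qed

section \<open>The conditions in the eigenframe of the distinguished vector\<close>

text \<open>Obtained by comparing matrix entries in the anticommutator, without a table of d. These
  are the components along the centralizer of e8, where K and its analogue for the square of Lambda
  must vanish.\<close>

lemma d_prod_entries:
  "d_prod v w $ 1 = (v $ 4 * w $ 6 + v $ 6 * w $ 4 + v $ 5 * w $ 7 + v $ 7 * w $ 5) / 2 + (v $ 1 * w $ 8 + v $ 8 * w $ 1) / sqrt 3"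
  "d_prod v w $ 2 = (v $ 5 * w $ 6 + v $ 6 * w $ 5 - v $ 4 * w $ 7 - v $ 7 * w $ 4) / 2 + (v $ 2 * w $ 8 + v $ 8 * w $ 2) / sqrt 3"
  "d_prod v w $ 3 = (v $ 4 * w $ 4 + v $ 5 * w $ 5 - v $ 6 * w $ 6 - v $ 7 * w $ 7) / 2 + (v $ 3 * w $ 8 + v $ 8 * w $ 3) / sqrt 3"
proof -
  let ?A = "su3_mat v ** su3_mat w + su3_mat w ** su3_mat v"
  let ?B = "mat (of_real (v \<bullet> w / 3)) + su3_mat (d_prod v w)"
  have e: "?A $ i $ j = ?B $ i $ j" for i j by (simp only: su3_mat_anticommutator)
  have "d_prod v w $ 1 = 2 * Re (?B $ 1 $ 2)" "d_prod v w $ 2 = - 2 * Im (?B $ 1 $ 2)"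
    "d_prod v w $ 3 = Re (?B $ 1 $ 1) - Re (?B $ 2 $ 2)"
    by (simp_all add: mat_def su3_mat_entries) (simp add: field_simps)
  then show
  "d_prod v w $ 1 = (v $ 4 * w $ 6 + v $ 6 * w $ 4 + v $ 5 * w $ 7 + v $ 7 * w $ 5) / 2 + (v $ 1 * w $ 8 + v $ 8 * w $ 1) / sqrt 3"
  "d_prod v w $ 2 = (v $ 5 * w $ 6 + v $ 6 * w $ 5 - v $ 4 * w $ 7 - v $ 7 * w $ 4) / 2 + (v $ 2 * w $ 8 + v $ 8 * w $ 2) / sqrt 3"
  "d_prod v w $ 3 = (v $ 4 * w $ 4 + v $ 5 * w $ 5 - v $ 6 * w $ 6 - v $ 7 * w $ 7) / 2 + (v $ 3 * w $ 8 + v $ 8 * w $ 3) / sqrt 3"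
    by (simp_all only: e[symmetric])
       (simp_all add: matrix_matrix_mult_def sum_3 su3_mat_entries algebra_simps add_divide_distrib diff_divide_distrib)
qed

lemma d_contract_entries:
  "d_contract A $ 1 = (A $ 4 $ 6 + A $ 6 $ 4 + A $ 5 $ 7 + A $ 7 $ 5) / 2 + (A $ 1 $ 8 + A $ 8 $ 1) / sqrt 3"
  "d_contract A $ 2 = (A $ 5 $ 6 + A $ 6 $ 5 - A $ 4 $ 7 - A $ 7 $ 4) / 2 + (A $ 2 $ 8 + A $ 8 $ 2) / sqrt 3"
  "d_contract A $ 3 = (A $ 4 $ 4 + A $ 5 $ 5 - A $ 6 $ 6 - A $ 7 $ 7) / 2 + (A $ 3 $ 8 + A $ 8 $ 3) / sqrt 3"
proof -
  have "d_contract A $ i = (\<Sum>j\<in>UNIV. \<Sum>k\<in>UNIV. d_prod (axis j 1) (axis k 1) $ i * A $ j $ k)" for i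
    by (simp add: d_contract_def d_prod_axis su3_d_cyclic[symmetric])
  note e = this[unfolded sum_8]
  show
  "d_contract A $ 1 = (A $ 4 $ 6 + A $ 6 $ 4 + A $ 5 $ 7 + A $ 7 $ 5) / 2 + (A $ 1 $ 8 + A $ 8 $ 1) / sqrt 3"
  "d_contract A $ 2 = (A $ 5 $ 6 + A $ 6 $ 5 - A $ 4 $ 7 - A $ 7 $ 4) / 2 + (A $ 2 $ 8 + A $ 8 $ 2) / sqrt 3"
  "d_contract A $ 3 = (A $ 4 $ 4 + A $ 5 $ 5 - A $ 6 $ 6 - A $ 7 $ 7) / 2 + (A $ 3 $ 8 + A $ 8 $ 3) / sqrt 3"
    unfolding e d_prod_entries
    by (simp_all add: axis_def field_simps)
qed

text \<open>Three pairwise proportional plane vectors; read by columns, this is parallelism of (x1,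
  x2, x3) and (y1, y2, y3) in R^3. A quarter turn of any nonzero one of them, normalized, is
  orthogonal to all.\<close>

lemma common_unit_normal:
  fixes x1 y1 x2 y2 x3 y3 :: real
  assumes "x1 * y2 = x2 * y1" "x1 * y3 = x3 * y1" "x2 * y3 = x3 * y2"
  shows "\<exists>m n. m\<^sup>2 + n\<^sup>2 = 1 \<and> m * x1 + n * y1 = 0 \<and> m * x2 + n * y2 = 0 \<and> m * x3 + n * y3 = 0"
    (is "\<exists>m n. ?P m n")
proof -
  have *: "\<exists>m n. ?P m n" if "x \<noteq> 0 \<or> y \<noteq> 0" "x * y1 = x1 * y" "x * y2 = x2 * y" "x * y3 = x3 * y" for x y
  proof -
    define s where "s = sqrt (x\<^sup>2 + y\<^sup>2)"
    have pos: "x\<^sup>2 + y\<^sup>2 > 0" using that(1) by (simp add: sum_power2_gt_zero_iff)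
    then have s: "s \<noteq> 0" "s\<^sup>2 = x\<^sup>2 + y\<^sup>2" by (auto simp: s_def)
    have "(- y / s)\<^sup>2 + (x / s)\<^sup>2 = (x\<^sup>2 + y\<^sup>2) / s\<^sup>2" by (simp add: power_divide add_divide_distrib)
    also have "\<dots> = 1" unfolding s(2)[symmetric] using s(1) by simp
    finally have "(- y / s)\<^sup>2 + (x / s)\<^sup>2 = 1" .
    moreover have "- y / s * x1 + x / s * y1 = 0" "- y / s * x2 + x / s * y2 = 0" "- y / s * x3 + x / s * y3 = 0"
      using s(1) that(2-4) by (simp_all add: field_simps)
    ultimately show ?thesis by blast
  qed
  consider "x1 \<noteq> 0 \<or> y1 \<noteq> 0" | "x2 \<noteq> 0 \<or> y2 \<noteq> 0" | "x3 \<noteq> 0 \<or> y3 \<noteq> 0"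
    | "x1 = 0" "y1 = 0" "x2 = 0" "y2 = 0" "x3 = 0" "y3 = 0" by blast
  then show ?thesis
  proof cases
    case 1 then show ?thesis by (rule *) (use assms in simp_all)
  next
    case 2 then show ?thesis by (rule *) (use assms in simp_all)
  next
    case 3 then show ?thesis by (rule *) (use assms in simp_all)
  next
    case 4 then show ?thesis by (intro exI[of _ 1] exI[of _ 0]) simp
  qed
qed

section \<open>CP4 transformations as rotations of the bilinears\<close>

definition cp4_rotation :: "real \<Rightarrow> real \<Rightarrow> real^8^8 \<Rightarrow> bool" where
  "cp4_rotation p q Q \<longleftrightarrow> p\<^sup>2 + q\<^sup>2 = 1 \<and> d_automorphism Q \<and>
    (\<forall>v. (Q *v v) $ 1 = - v $ 1 \<and> (Q *v v) $ 2 = - v $ 2 \<and> (Q *v v) $ 3 = - v $ 3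
    \<and> (Q *v v) $ 4 = - p * v $ 6 + q * v $ 7 \<and> (Q *v v) $ 5 = q * v $ 6 + p * v $ 7
    \<and> (Q *v v) $ 6 = p * v $ 4 - q * v $ 5 \<and> (Q *v v) $ 7 = - q * v $ 4 - p * v $ 5
    \<and> (Q *v v) $ 8 = v $ 8)"

lemma cp4_rotation_exists:
  assumes xy: "cmod x = 1" "cmod y = 1"
  obtains Q where "cp4_rotation (Re (x * cnj y)) (Im (x * cnj y)) Q"
    "\<And>v. su3_mat (Q *v v) = transpose (dagger (cp4_matrix x y) ** su3_mat v ** cp4_matrix x y)"
proof -
  have "unitary_matrix (cp4_matrix x y)" using xy by (simp add: unitary_cp4_matrix)
  then obtain Q where d: "d_automorphism Q"
    and Q: "\<And>v. su3_mat (Q *v v) = transpose (dagger (cp4_matrix x y) ** su3_mat v ** cp4_matrix x y)"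
    using antiunitary_automorphism by blast
  have "cmod (x * cnj y) = 1" using xy by (simp add: norm_mult)
  then have "(Re (x * cnj y))\<^sup>2 + (Im (x * cnj y))\<^sup>2 = 1" by (metis cmod_power2 one_power2)
  then have "cp4_rotation (Re (x * cnj y)) (Im (x * cnj y)) Q"
    using d cp4_adjoint_action[OF Q xy] unfolding cp4_rotation_def by blast
  then show thesis using Q that by blast
qed

text \<open>The map J squares to -1, so J w = s w with s^2 = 1 gives w = J (J w) = -w.\<close>

lemma quarter_turn_no_eigenvector:
  fixes p q :: real
  assumes "p\<^sup>2 + q\<^sup>2 = 1" "s = 1 \<or> s = - 1"
    and "- p * c + q * d = s * a" "q * c + p * d = s * b" "p * a - q * b = s * c" "- q * a - p * b = s * d"
  shows "a = 0" "b = 0" "c = 0" "d = 0"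
proof -
  have ss: "s * s = 1" using assms(2) by auto
  have pq: "p * p + q * q = 1" using assms(1) by (simp add: power2_eq_square)
  have "a = - a" "b = - b" "c = - c" "d = - d" using assms(3-6) ss pq by algebra+
  then show "a = 0" "b = 0" "c = 0" "d = 0" by simp_all
qed

text \<open>With \<open>cp4_rotation_negated\<close> this rewrites "parallel to e8" and "in the
  centralizer of e8" as eigenvalue statements, which anything commuting with Q respects.\<close>

lemma cp4_rotation_fixed:
  assumes Q: "cp4_rotation p q Q"
  shows "Q *v v = v \<longleftrightarrow> parallel_to v (axis 8 1)"
proof
  assume eq: "Q *v v = v"
  then have e: "(Q *v v) $ i = v $ i" for i by simp
  have "v $ 4 = 0" "v $ 5 = 0" "v $ 6 = 0" "v $ 7 = 0"
    using Q quarter_turn_no_eigenvector[of p q 1 "v $ 6" "v $ 7" "v $ 4" "v $ 5"]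
      e[of 4] e[of 5] e[of 6] e[of 7] unfolding cp4_rotation_def by simp_all
  moreover have "v $ 1 = 0" "v $ 2 = 0" "v $ 3 = 0"
    using Q e[of 1] e[of 2] e[of 3] unfolding cp4_rotation_def by simp_all
  ultimately have "v = v $ 8 *\<^sub>R axis 8 1" by (simp add: vec_eq_iff forall_8 axis_def)
  then show "parallel_to v (axis 8 1)" unfolding parallel_to_def by blast
next
  assume "parallel_to v (axis 8 1)"
  then obtain c where c: "v = c *\<^sub>R axis 8 1" by (auto simp: parallel_to_def)
  have "v $ 1 = 0" "v $ 2 = 0" "v $ 3 = 0" "v $ 4 = 0" "v $ 5 = 0" "v $ 6 = 0" "v $ 7 = 0"
    unfolding c by (simp_all add: axis_def)
  then show "Q *v v = v"
    using Q unfolding cp4_rotation_def by (simp add: vec_eq_iff forall_8)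
qed

lemma cp4_rotation_negated:
  assumes Q: "cp4_rotation p q Q"
  shows "Q *v v = - v \<longleftrightarrow> v \<in> f_centralizer (axis 8 1)"
proof
  assume eq: "Q *v v = - v"
  then have e: "(Q *v v) $ i = - v $ i" for i by simp
  have "v $ 4 = 0" "v $ 5 = 0" "v $ 6 = 0" "v $ 7 = 0"
    using Q quarter_turn_no_eigenvector[of p q "- 1" "v $ 6" "v $ 7" "v $ 4" "v $ 5"]
      e[of 4] e[of 5] e[of 6] e[of 7] unfolding cp4_rotation_def by simp_all
  moreover have "v $ 8 = 0"
    using Q e[of 8] unfolding cp4_rotation_def by simp
  ultimately show "v \<in> f_centralizer (axis 8 1)" by (simp add: f_centralizer_axis_8)
next
  assume "v \<in> f_centralizer (axis 8 1)"
  then have "v $ 4 = 0" "v $ 5 = 0" "v $ 6 = 0" "v $ 7 = 0" "v $ 8 = 0"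
    by (simp_all only: f_centralizer_axis_8)
  then show "Q *v v = - v"
    using Q unfolding cp4_rotation_def by (simp add: vec_eq_iff forall_8)
qed

lemma d_automorphism_commute:
  assumes "d_automorphism Q"
  shows "Q ** A ** transpose Q = A \<longleftrightarrow> Q ** A = A ** Q"
  using d_automorphism_orthogonal[OF assms]
  by (metis matrix_mul_assoc matrix_mul_rid)

text \<open>Each vector in the conditions is built equivariantly from Q-invariant data, so Q fixes
  it; likewise A preserves the space that Q negates.\<close>

lemma cp4_invariant_adjoint_condition:
  assumes Q: "cp4_rotation p q Q"
    and inv: "Q *v M = M" "Q *v L = L" "Q ** A ** transpose Q = A"
  shows "adjoint_condition M L A (axis 8 1)"
proof -
  let ?e = "axis 8 1 :: real^8"
  have d: "d_automorphism Q" using Q by (simp add: cp4_rotation_def)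
  have QA: "Q ** A = A ** Q" using inv(3) d_automorphism_commute[OF d] by simp
  then have comm: "Q *v (A *v v) = A *v (Q *v v)" for v
    by (simp only: matrix_vector_mul_assoc)
  have AA: "Q ** (A ** A) ** transpose Q = A ** A"
    unfolding d_automorphism_commute[OF d] using QA by (metis matrix_mul_assoc)
  note fixed = cp4_rotation_fixed[OF Q]
  have e: "Q *v ?e = ?e" unfolding fixed parallel_to_def by (intro exI[of _ 1]) simp
  have "parallel_to (A *v ?e) ?e" unfolding fixed[symmetric] comm e ..
  moreover have "self_aligned ?e"
    unfolding self_aligned_d_prod fixed[symmetric] using d e unfolding d_automorphism_def by metis
  moreover have "A *v w \<in> f_centralizer ?e" if "w \<in> f_centralizer ?e" for w
  proof -
    have "Q *v w = - w" using that by (simp only: cp4_rotation_negated[OF Q])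
    then have "Q *v (A *v w) = - (A *v w)"
      unfolding comm by (simp add: matrix_vector_mult_def vec_eq_iff sum_negf)
    then show ?thesis by (simp only: cp4_rotation_negated[OF Q])
  qed
  moreover have "parallel_to (d_contract A) ?e"
    unfolding fixed[symmetric] d_contract_conjugate[OF d, symmetric] inv ..
  moreover have "parallel_to (d_contract (A ** A)) ?e"
    unfolding fixed[symmetric] d_contract_conjugate[OF d, symmetric] AA ..
  moreover have "?e \<noteq> 0" by (simp add: axis_eq_0_iff)
  ultimately show ?thesis using inv fixed by (simp add: adjoint_condition_def)
qed

text \<open>On the components 4, ..., 7 write \<open>A\<close> in \<open>2 \<times> 2\<close> blocks. Its symmetric traceless parts are vectors
  in the plane: \<open>(g, h)\<close> for the off-diagonal block, and \<open>(a - b, 2e)\<close>, \<open>(c - d, 2f)\<close> for the diagonal ones.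
  A CP4 rotation commutes with \<open>A\<close> iff a unit vector is orthogonal to the first and to the difference
  of the other two, and parallel to their sum; the condition on \<open>A\<^sup>2\<close> makes these requirements compatible.\<close>

lemma adjoint_condition_cp4_invariant:
  assumes cond: "adjoint_condition M L A (axis 8 1)" and sym: "transpose A = A"
  shows "\<exists>p q. p\<^sup>2 + q\<^sup>2 = 1 \<and> (\<forall>Q. cp4_rotation p q Q \<longrightarrow>
    Q *v M = M \<and> Q *v L = L \<and> Q ** A ** transpose Q = A)"
proof -
  let ?e = "axis 8 1 :: real^8"
  have sym': "A $ i $ j = A $ j $ i" for i j using sym by (metis transpose_entry)
  have par: "v $ 1 = 0" "v $ 2 = 0" "v $ 3 = 0" "v $ 4 = 0" "v $ 5 = 0" "v $ 6 = 0" "v $ 7 = 0"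
    if "parallel_to v ?e" for v
    using that by (auto simp: parallel_to_def axis_def)
  have "parallel_to (A *v ?e) ?e" using cond by (simp only: adjoint_condition_def)
  then have A8: "A $ 1 $ 8 = 0" "A $ 2 $ 8 = 0" "A $ 3 $ 8 = 0" "A $ 4 $ 8 = 0" "A $ 5 $ 8 = 0"
     "A $ 6 $ 8 = 0" "A $ 7 $ 8 = 0"
    using par[of "column 8 A"] by (simp_all only: matrix_vector_mult_basis) (simp_all add: column_def)
  have A8': "A $ 8 $ 1 = 0" "A $ 8 $ 2 = 0" "A $ 8 $ 3 = 0" "A $ 8 $ 4 = 0" "A $ 8 $ 5 = 0"
     "A $ 8 $ 6 = 0" "A $ 8 $ 7 = 0"
    using A8 by (simp_all add: sym'[of 8])
  have col: "A $ 4 $ j = 0 \<and> A $ 5 $ j = 0 \<and> A $ 6 $ j = 0 \<and> A $ 7 $ j = 0"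
    if "axis j 1 \<in> f_centralizer ?e" for j
  proof -
    have "A *v axis j 1 \<in> f_centralizer ?e" using cond that by (simp only: adjoint_condition_def)
    then show ?thesis
      by (simp only: f_centralizer_axis_8 matrix_vector_mult_basis) (simp add: column_def)
  qed
  have "axis 1 1 \<in> f_centralizer ?e" "axis 2 1 \<in> f_centralizer ?e" "axis 3 1 \<in> f_centralizer ?e"
    by (simp_all only: f_centralizer_axis_8) (simp_all add: axis_def)
  note c = col[OF this(1)] col[OF this(2)] col[OF this(3)]
  have off: "A $ 4 $ 1 = 0" "A $ 5 $ 1 = 0" "A $ 6 $ 1 = 0" "A $ 7 $ 1 = 0"
    "A $ 4 $ 2 = 0" "A $ 5 $ 2 = 0" "A $ 6 $ 2 = 0" "A $ 7 $ 2 = 0"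
    "A $ 4 $ 3 = 0" "A $ 5 $ 3 = 0" "A $ 6 $ 3 = 0" "A $ 7 $ 3 = 0"
    using c by simp_all
  then have off': "A $ 1 $ 4 = 0" "A $ 1 $ 5 = 0" "A $ 1 $ 6 = 0" "A $ 1 $ 7 = 0"
    "A $ 2 $ 4 = 0" "A $ 2 $ 5 = 0" "A $ 2 $ 6 = 0" "A $ 2 $ 7 = 0"
    "A $ 3 $ 4 = 0" "A $ 3 $ 5 = 0" "A $ 3 $ 6 = 0" "A $ 3 $ 7 = 0"
    by (simp_all add: sym'[of 1] sym'[of 2] sym'[of 3])
  \<comment> \<open>The diagonal 2x2 blocks are (a, e; e, b) on components 4, 5 and (c, f; f, d) on
    6, 7; g, h is the first row of the block between them.\<close>
  define a b c d e f g h where "a = A $ 4 $ 4" and "b = A $ 5 $ 5" and "c = A $ 6 $ 6" and "d = A $ 7 $ 7"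
    and "e = A $ 4 $ 5" and "f = A $ 6 $ 7" and "g = A $ 4 $ 6" and "h = A $ 4 $ 7"
  note defs = this
  have "parallel_to (d_contract A) ?e" using cond by (simp only: adjoint_condition_def)
  from par(1-3)[OF this] have K: "A $ 5 $ 7 = - g" "A $ 5 $ 6 = h" "b = c + d - a"
    unfolding d_contract_entries
    by (simp_all add: A8 A8' sym'[of 6 4] sym'[of 7 5] sym'[of 6 5] sym'[of 7 4] defs)
  have low: "A $ 5 $ 4 = e" "A $ 7 $ 6 = f" "A $ 6 $ 4 = g" "A $ 7 $ 4 = h" "A $ 7 $ 5 = - g" "A $ 6 $ 5 = h"
    using K(1,2) by (simp_all add: defs sym'[of 5 4] sym'[of 7] sym'[of 6 4] sym'[of 6 5])
  note entries = defs[symmetric] K(1,2) low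
  have "parallel_to (d_contract (A ** A)) ?e" using cond by (simp only: adjoint_condition_def)
  note K2 = par(1-3)[OF this, unfolded d_contract_entries]
  have "g * (a - b + (c - d)) + 2 * h * (e + f) = 0"
    using K2(1)
    by (simp add: matrix_matrix_mult_def sum_8 A8 A8' off off' entries) (simp add: algebra_simps)
  moreover have "2 * g * (e - f) = h * ((a - b) - (c - d))"
    using K2(2)
    by (simp add: matrix_matrix_mult_def sum_8 A8 A8' off off' entries) (simp add: algebra_simps)
  moreover have "a * a + b * b + 2 * e * e = c * c + d * d + 2 * f * f"
    using K2(3)
    by (simp add: matrix_matrix_mult_def sum_8 A8 A8' off off' entries)
  \<comment> \<open>Pairwise determinants of three plane vectors: (g, h), the difference of the two
    diagonal vectors, and their sum turned by a right angle, so that "parallel to the sum" also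
    becomes an orthogonality. The last determinant says that the two diagonal vectors have equal
    length.\<close>
  ultimately have K2': "g * (2 * (e - f)) = ((a - b) - (c - d)) * h"
    "g * (- ((a - b) + (c - d))) = (2 * (e + f)) * h"
    "((a - b) - (c - d)) * (- ((a - b) + (c - d))) = (2 * (e + f)) * (2 * (e - f))"
    using K(3) by algebra+
  from common_unit_normal[OF this] obtain m q where mq: "m\<^sup>2 + q\<^sup>2 = 1" "m * g + q * h = 0"
    "m * ((a - b) - (c - d)) + q * (2 * (e - f)) = 0" "m * (2 * (e + f)) + q * (- ((a - b) + (c - d))) = 0"
    by blast
  \<comment> \<open>A CP4 rotation maps components 6, 7 to 4, 5 by the matrix with rows (-p, q) and
    (q, p); its vector (-p, q) is to be the unit normal just found.\<close>
  define p where "p = - m"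
  \<comment> \<open>The first three are the orthogonality relations rewritten; the last two are the
    trace equation times p and q, prepared for \<open>algebra\<close>.\<close>
  have E: "p * g = q * h" "p * a - p * c = q * e - q * f" "p * e + p * f = q * d - q * a"
    "p * b = p * c + p * d - p * a" "q * b = q * c + q * d - q * a"
    using mq(2-4) K(3) unfolding p_def by algebra+
  have "Q *v M = M \<and> Q *v L = L \<and> Q ** A ** transpose Q = A" if Q: "cp4_rotation p q Q" for Q
  proof -
    have dQ: "d_automorphism Q" and act: "(Q *v v) $ 1 = - v $ 1" "(Q *v v) $ 2 = - v $ 2" "(Q *v v) $ 3 = - v $ 3"
      "(Q *v v) $ 4 = - p * v $ 6 + q * v $ 7" "(Q *v v) $ 5 = q * v $ 6 + p * v $ 7"
      "(Q *v v) $ 6 = p * v $ 4 - q * v $ 5" "(Q *v v) $ 7 = - q * v $ 4 - p * v $ 5" "(Q *v v) $ 8 = v $ 8" for v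
      using Q by (simp_all add: cp4_rotation_def)
    have Qe: "Q $ i $ j = (Q *v axis j 1) $ i" for i j
      by (simp add: matrix_vector_mult_basis column_def)
    have QAe: "(Q ** A) $ i $ j = (Q *v column j A) $ i" for i j
      by (simp add: matrix_matrix_mult_def matrix_vector_mult_def column_def)
    have "(Q ** A) $ i $ j = (A ** Q) $ i $ j" for i j
    proof -
      have "\<forall>i j. (Q ** A) $ i $ j = (A ** Q) $ i $ j"
        unfolding forall_8 QAe act matrix_matrix_mult_def sum_8 vec_lambda_beta Qe column_def
        by (simp add: axis_def A8 A8' off off' entries) (insert E, intro conjI; algebra)
      then show ?thesis by blast
    qed
    then have "Q ** A = A ** Q" by (simp add: vec_eq_iff)
    then have "Q ** A ** transpose Q = A" by (rule d_automorphism_commute[OF dQ, THEN iffD2])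
    then show ?thesis
      using cond by (simp add: adjoint_condition_def cp4_rotation_fixed[OF Q])
  qed
  moreover have "p\<^sup>2 + q\<^sup>2 = 1" using mq(1) by (simp add: p_def)
  ultimately show ?thesis by blast
qed

section \<open>The two implications and the equivalence\<close>

lemma dim_f_centralizer_self_aligned:
  assumes "v \<noteq> 0" "self_aligned v"
  shows "dim (f_centralizer v) = 3"
proof -
  obtain U c where U: "unitary_matrix U" and c: "c \<noteq> 0" "dagger U ** su3_mat v ** U = su3_mat (c *\<^sub>R axis 8 1)"
    using self_aligned_diagonal[OF assms] by blast
  obtain Q where d: "d_automorphism Q" and Q: "\<And>v. su3_mat (Q *v v) = dagger U ** su3_mat v ** U"
    using unitary_automorphism[OF U] by blast
  have "Q *v v = c *\<^sub>R axis 8 1" using Q[of v] c(2) by simp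
  then show ?thesis
    using dim_f_centralizer_rotate[OF U d Q, of v] c(1)
    by (simp add: f_centralizer_scaleR dim_f_centralizer_axis_8)
qed

lemma transpose_conjugate:
  fixes A Q :: "real^'n^'n"
  shows "transpose A = A \<Longrightarrow> transpose (Q ** A ** transpose Q) = Q ** A ** transpose Q"
  by (simp add: matrix_transpose_mul matrix_mul_assoc)

lemma CP4_symmetry_adjoint_condition:
  assumes sym: "transpose A = A" and V: "has_CP4_symmetry (bilinear_potential m M l L A)"
  shows "\<exists>v. adjoint_condition M L A v"
proof -
  obtain X where X: "unitary_matrix X" "cp_order_4 X"
    and inv: "\<And>\<phi>. bilinear_potential m M l L A (cp_transform X \<phi>) = bilinear_potential m M l L A \<phi>"
    using V by (auto simp: has_CP4_symmetry_def cp_symmetry_def)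
  obtain U x y where U: "unitary_matrix U" and xy: "cmod x = 1" "cmod y = 1"
    and Y: "dagger U ** X ** cnj_matrix U = cp4_matrix x y"
    using cp4_normal_form[OF X] by blast
  obtain Q where d: "d_automorphism Q" and Q: "\<And>v. su3_mat (Q *v v) = dagger U ** su3_mat v ** U"
    using unitary_automorphism[OF U] by blast
  obtain P where P: "cp4_rotation (Re (x * cnj y)) (Im (x * cnj y)) P"
    and P': "\<And>v. su3_mat (P *v v) = transpose (dagger (cp4_matrix x y) ** su3_mat v ** cp4_matrix x y)"
    using cp4_rotation_exists[OF xy] by blast
  have uY: "unitary_matrix (cp4_matrix x y)" using xy by (simp add: unitary_cp4_matrix)
  let ?M = "Q *v M" and ?L = "Q *v L" and ?A = "Q ** A ** transpose Q"
  have rotated: "bilinear_potential m M l L A (U ** \<phi>) = bilinear_potential m ?M l ?L ?A \<phi>" for \<phi>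
    by (rule bilinear_potential_transform) (rule bilin_unitary[OF U Q])+
  have "bilinear_potential m (P *v ?M) l (P *v ?L) (P ** ?A ** transpose P) \<phi>
      = bilinear_potential m ?M l ?L ?A \<phi>" for \<phi>
  proof -
    \<comment> \<open>In the new frame the normal form acts exactly as X does in the old
      one.\<close>
    have "U ** cp_transform (cp4_matrix x y) \<phi> = (U ** dagger U) ** X ** cnj_matrix U ** cnj_matrix \<phi>"
      by (simp only: cp_transform_mult Y[symmetric] matrix_mul_assoc)
    then have "U ** cp_transform (cp4_matrix x y) \<phi> = cp_transform X (U ** \<phi>)"
      using U by (simp add: unitary_matrix_iff cp_transform_mult cnj_matrix_mult matrix_mul_assoc)
    then have "bilinear_potential m ?M l ?L ?A (cp_transform (cp4_matrix x y) \<phi>)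
        = bilinear_potential m ?M l ?L ?A \<phi>"
      by (simp only: rotated[symmetric] inv)
    moreover have "bilinear_potential m ?M l ?L ?A (cp_transform (cp4_matrix x y) \<phi>)
        = bilinear_potential m (P *v ?M) l (P *v ?L) (P ** ?A ** transpose P) \<phi>"
      by (rule bilinear_potential_transform) (rule bilin_antiunitary[OF uY P'])+
    ultimately show ?thesis by simp
  qed
  \<comment> \<open>Only symmetric quadratic coefficients are unique, so symmetry has to be carried
    through both conjugations.\<close>
  note unique = bilinear_potential_unique[OF this transpose_conjugate[OF transpose_conjugate[OF sym]]
    transpose_conjugate[OF sym]]
  have "adjoint_condition ?M ?L ?A (axis 8 1)"
    by (rule cp4_invariant_adjoint_condition[OF P unique])
  then have "adjoint_condition ?M ?L ?A (Q *v (transpose Q *v axis 8 1))"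
    by (simp only: d_automorphism_inverse[OF d])
  then show ?thesis unfolding adjoint_condition_rotate[OF U d Q] by blast
qed

lemma adjoint_condition_CP4_symmetry:
  assumes sym: "transpose A = A" and v: "adjoint_condition M L A v"
  shows "has_CP4_symmetry (bilinear_potential m M l L A)"
proof -
  have "v \<noteq> 0" "self_aligned v" using v by (simp_all add: adjoint_condition_def)
  then obtain U c where U: "unitary_matrix U" and c: "c \<noteq> 0" "dagger U ** su3_mat v ** U = su3_mat (c *\<^sub>R axis 8 1)"
    using self_aligned_diagonal by blast
  obtain Q where d: "d_automorphism Q" and Q: "\<And>v. su3_mat (Q *v v) = dagger U ** su3_mat v ** U"
    using unitary_automorphism[OF U] by blast
  let ?M = "Q *v M" and ?L = "Q *v L" and ?A = "Q ** A ** transpose Q"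
  have "Q *v v = c *\<^sub>R axis 8 1" using Q[of v] c(2) by simp
  then have "adjoint_condition ?M ?L ?A (axis 8 1)"
    using v adjoint_condition_rotate[OF U d Q, of M L A v] adjoint_condition_scaleR[OF c(1)] by simp
  from adjoint_condition_cp4_invariant[OF this transpose_conjugate[OF sym]]
  obtain p q where pq: "p\<^sup>2 + q\<^sup>2 = 1"
    and fixed: "\<And>P. cp4_rotation p q P \<Longrightarrow> P *v ?M = ?M \<and> P *v ?L = ?L \<and> P ** ?A ** transpose P = ?A"
    by blast
  \<comment> \<open>Only the ratio of the two phases acts on the bilinears, so the second one may be
    1 and the first carries the whole angle.\<close>
  let ?x = "Complex p q" and ?Y = "cp4_matrix (Complex p q) 1"
  have x: "cmod ?x = 1" "cmod (1 :: complex) = 1" using pq by (simp_all add: cmod_def)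
  obtain P where P: "cp4_rotation p q P"
    and P': "\<And>v. su3_mat (P *v v) = transpose (dagger ?Y ** su3_mat v ** ?Y)"
    using cp4_rotation_exists[OF x] by auto
  have uY: "unitary_matrix ?Y" using x by (simp add: unitary_cp4_matrix)
  have rotated: "bilinear_potential m M l L A (U ** \<phi>) = bilinear_potential m ?M l ?L ?A \<phi>" for \<phi>
    by (rule bilinear_potential_transform) (rule bilin_unitary[OF U Q])+
  have "bilinear_potential m ?M l ?L ?A (cp_transform ?Y \<phi>)
      = bilinear_potential m (P *v ?M) l (P *v ?L) (P ** ?A ** transpose P) \<phi>" for \<phi>
    by (rule bilinear_potential_transform) (rule bilin_antiunitary[OF uY P'])+
  then have inv: "bilinear_potential m ?M l ?L ?A (cp_transform ?Y \<phi>) = bilinear_potential m ?M l ?L ?A \<phi>" for \<phi>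
    using fixed[OF P] by simp
  \<comment> \<open>The transformation law of a CP matrix under the basis change that returns to the
    original frame.\<close>
  define X where "X = U ** ?Y ** transpose U"
  have UU: "U ** dagger U = mat 1" "dagger U ** U = mat 1" using U by (simp_all add: unitary_matrix_iff)
  have tU: "transpose U ** cnj_matrix U = mat 1"
  proof -
    have "transpose U ** cnj_matrix U = cnj_matrix (dagger U ** U)"
      by (simp add: cnj_matrix_mult dagger_def cnj_matrix_def transpose_def vec_eq_iff matrix_matrix_mult_def)
    then show ?thesis by (simp add: UU)
  qed
  have "unitary_matrix X"
    unfolding X_def by (intro unitary_matrix_mult unitary_matrix_transpose U uY)
  moreover have "bilinear_potential m M l L A (cp_transform X \<phi>) = bilinear_potential m M l L A \<phi>" for \<phi>
  proof -
    define \<psi> where "\<psi> = dagger U ** \<phi>"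
    have \<phi>: "\<phi> = U ** \<psi>" by (simp add: \<psi>_def matrix_mul_assoc UU)
    have "cp_transform X \<phi> = U ** ?Y ** (transpose U ** cnj_matrix U) ** cnj_matrix \<psi>"
      by (simp only: \<phi> cp_transform_mult cnj_matrix_mult X_def matrix_mul_assoc)
    then have "cp_transform X \<phi> = U ** cp_transform ?Y \<psi>"
      by (simp add: tU cp_transform_mult matrix_mul_assoc)
    then show ?thesis by (simp only: \<phi> rotated inv)
  qed
  moreover have "cp_order_4 X"
  proof -
    have "X ** cnj_matrix X = U ** ?Y ** (transpose U ** cnj_matrix U) ** cnj_matrix ?Y ** cnj_matrix (transpose U)"
      by (simp only: X_def cnj_matrix_mult matrix_mul_assoc)
    also have "cnj_matrix (transpose U) = dagger U"
      by (simp add: dagger_def cnj_matrix_def transpose_def)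
    also have "U ** ?Y ** (transpose U ** cnj_matrix U) ** cnj_matrix ?Y ** dagger U
        = U ** (?Y ** cnj_matrix ?Y) ** dagger U"
      by (simp only: tU matrix_mul_rid matrix_mul_assoc)
    finally have XX: "X ** cnj_matrix X = U ** reflection_3 ** dagger U"
      by (simp only: cp4_matrix_square[OF x])
    have "dagger U ** (X ** cnj_matrix X) ** U = (dagger U ** U) ** reflection_3 ** (dagger U ** U)"
      by (simp only: XX matrix_mul_assoc)
    then have conj: "dagger U ** (X ** cnj_matrix X) ** U = reflection_3" by (simp add: UU)
    have "(reflection_3 $ 1 $ 1 :: complex) \<noteq> mat 1 $ 1 $ 1" by (simp add: reflection_3_def mat_def)
    then have "reflection_3 \<noteq> mat 1" by metis
    then have "X ** cnj_matrix X \<noteq> mat 1"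
      using conj unitary_conjugate_mat[OF U, of 1] by metis
    moreover have "(X ** cnj_matrix X) ** (X ** cnj_matrix X)
        = U ** reflection_3 ** (dagger U ** U) ** reflection_3 ** dagger U"
      by (simp only: XX matrix_mul_assoc)
    moreover have "reflection_3 ** reflection_3 = mat 1"
      by (simp add: vec_eq_iff forall_3 matrix_matrix_mult_def sum_3 reflection_3_def mat_def)
    ultimately show ?thesis
      unfolding cp_order_4_def by (simp add: UU matrix_mul_assoc[symmetric])
  qed
  ultimately show ?thesis unfolding has_CP4_symmetry_def cp_symmetry_def by blast
qed

theorem theorem1:
  fixes V :: "doublets \<Rightarrow> real"
    and M\<^sub>0 \<Lambda>\<^sub>0 :: real
    and M L :: "real^8"
    and \<Lambda> :: "real^8^8"
  assumes "renormalizable_potential V"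
    and "V = bilinear_potential M\<^sub>0 M \<Lambda>\<^sub>0 L \<Lambda>"
    and "transpose \<Lambda> = \<Lambda>"
  shows "has_CP4_symmetry V \<longleftrightarrow>
    (\<exists>v8 :: real^8. v8 \<noteq> 0
       \<and> eigenvector_of \<Lambda> v8 \<and> self_aligned v8
       \<and> (\<exists>S. f_orthogonal_eigenvectors \<Lambda> v8 S \<and> card S = 3)
       \<and> (\<forall>S. f_orthogonal_eigenvectors \<Lambda> v8 S \<longrightarrow> finite S \<and> card S \<le> 3)
       \<and> (\<forall>w \<in> {M, L, d_contract \<Lambda>, d_contract (\<Lambda> ** \<Lambda>)}. w \<noteq> 0 \<longrightarrow> parallel_to w v8))"
proof -
  have zero: "parallel_to 0 v" for v :: "real^8"
    unfolding parallel_to_def by (intro exI[of _ 0]) simp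
  have "(v8 \<noteq> 0 \<and> eigenvector_of \<Lambda> v8 \<and> self_aligned v8
       \<and> (\<exists>S. f_orthogonal_eigenvectors \<Lambda> v8 S \<and> card S = 3)
       \<and> (\<forall>S. f_orthogonal_eigenvectors \<Lambda> v8 S \<longrightarrow> finite S \<and> card S \<le> 3)
       \<and> (\<forall>w \<in> {M, L, d_contract \<Lambda>, d_contract (\<Lambda> ** \<Lambda>)}. w \<noteq> 0 \<longrightarrow> parallel_to w v8))
     \<longleftrightarrow> adjoint_condition M L \<Lambda> v8" for v8
  \<comment> \<open>For nonzero self-aligned vectors the centralizer has dimension 3, as the
    eigenvector count requires; in the other case both sides are false.\<close>
  proof (cases "v8 \<noteq> 0 \<and> self_aligned v8")
    case True
    then have dim: "dim (f_centralizer v8) = 3" by (simp add: dim_f_centralizer_self_aligned)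
    have "(w \<noteq> 0 \<longrightarrow> parallel_to w v8) \<longleftrightarrow> parallel_to w v8" for w using zero by auto
    moreover have "eigenvector_of \<Lambda> v8 \<longleftrightarrow> parallel_to (\<Lambda> *v v8) v8"
      using True by (simp add: eigenvector_of_def parallel_to_def)
    ultimately show ?thesis
      using True eigenvectors_iff_invariant[OF assms(3) dim] unfolding adjoint_condition_def by auto
  next
    case False
    then show ?thesis unfolding adjoint_condition_def by blast
  qed
  then show ?thesis
    using CP4_symmetry_adjoint_condition adjoint_condition_CP4_symmetry assms(2,3) by metis
qed

end
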